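(* Let $\epsilon>0$ and $\delta\in(0,1)$. The FastLloyd protocol, run among $M$ clients $p_1,\dots,p_M$ and a server $S$ with noise calibrated to $(\epsilon,\delta)$ (protocol, noise calibration and security notion as defined in the context), satisfies $(\epsilon(\lambda),\delta)$-IND-CDP-MPC in the presence of a semi-honest, probabilistic polynomial time (in $\lambda$) adversary who controls at most a single party (one client or the server).
   Context: **Neighbouring datasets.** Two datasets are neighbouring if they differ by adding or removing a single data point in $[-B,B]^d$. **Security notion.** A multi-party protocol $\Pi$ satisfies $(\epsilon(\lambda),\delta)$-indistinguishable computational differential privacy (IND-CDP-MPC) if for every probabilistic polynomial time (in the security parameter $\lambda$) adversary $A$ with input dataset $D_A$ (empty if $A$ is the server), and for all neighbouring datasets $D,D'$ belonging to the honest parties (i.e. values of the union of the datasets of the parties other than $A$), $$\Pr[\mathcal{A}(\mathrm{view}_A^{\Pi}(D_A,D))=1]\le e^{\epsilon}\,\Pr[\mathcal{A}(\mathrm{view}_A^{\Pi}(D_A,D'))=1]+\mathrm{negl}(\lambda)+\delta ,$$ where $\mathcal{A}$ is the adversary's (0/1-valued) decision function, $\mathrm{view}_A^\Pi$ is the transcript of all messages observed by $A$ during the execution of $\Pi$ (a client also knows the shared seed and its own data), and $\mathrm{negl}$ decreases faster than any inverse polynomial. The same must hold for every party's view. **Setting.** Client $p_i$ holds a finite dataset $D_i\subset[-B,B]^d$. Public parameters: number of clusters $k$, number of iterations $T$, radius $\eta>0$, fixed-point precision $q$, ring $\mathbf{R}=\mathbb{Z}_{2^{w}}$ (e.g. $w=32$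 or $64$). All clients share a secret random seed for a cryptographically secure pseudorandom number generator (PRNG); the seed is unknown to the server. Clients do not collude with the server. All parties follow the protocol (honest-but-curious). **Noise calibration.** With $\Phi$ the standard normal CDF, $\sigma>0$ is the smallest value such that, with $\theta=1/\sigma$, $\Phi(-\epsilon/\theta+\theta/2)-e^{\epsilon}\Phi(-\epsilon/\theta-\theta/2)\le\delta$. Set $$\sigma^{R}=\frac{\sigma\sqrt{1+\sqrt{4d}}}{\sqrt[4]{4d}},\qquad \sigma^{C}=\sigma\sqrt{1+\sqrt{4d}} .$$ **Protocol FastLloyd.** Initialization: every client computes the same initial centroids $\tilde\mu^{(0)}_1,\dots,\tilde\mu^{(0)}_k$ from the shared seed by a data-independent randomized procedure (sphere packing). For $t=1,\dots,T$: 1. Assignment (local): client $i$ considers each $x\in D_i$ for the cluster $j'$ with nearest centroid $\tilde\mu_{j'}^{(t-1)}$ and places $x$ in $O_{ij'}^{(t)}$ if $\|x-\tilde\mu_{j'}^{(t-1)}\|_2<\eta$; otherwise $x$ is discarded. 2. Local update: client $i$ computes, for each $j$, $\bar R_{ij}^{(t)}=\sum_{x\in O_{ij}^{(t)}}(x-\tilde\mu_j^{(t-1)})\in\mathbb{R}^d$ and $\bar C_{ij}^{(t)}=|O_{ij}^{(t)}|$. 3. Global update: the parties run GlobalMSA on the $k\times d$ matrices $(\bar R_{ij}^{(t)})_j$ with noise standard deviation $\sigma^{R}\eta\sqrt{T}$, and on the $k\times 1$ matrices $(\bar C_{ij}^{(t)})_j$ with noise standard deviation $\sigma^{C}\sqrt{T}$,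 obtaining noisy sums $\tilde R_j^{(t)}$ and $\tilde C_j^{(t)}$. 4. Post-processing (local): each client computes $\tilde R_j^{(t)}/\tilde C_j^{(t)}+\tilde\mu_j^{(t-1)}$; if this is at distance more than $\eta$ from $\tilde\mu_j^{(t-1)}$ it is truncated to distance $\eta$; then each coordinate is folded into $[-B,B]$ by a fixed deterministic map (reflection over the boundary). The result is $\tilde\mu_j^{(t)}$. The output to the clients is $\tilde\mu^{(T)}$. **GlobalMSA (Masked Secure Aggregation)** on private matrices $v_1,\dots,v_M$ with noise standard deviation $s$: (i) from the PRNG and shared seed, each client derives the same masks $r_1,\dots,r_M$, matrices of the same shape as the $v_i$ with (pseudo)uniform entries in $\mathbf{R}$, fresh for each invocation, and $r=\sum_i r_i$; (ii) client $i$ computes $\tilde v_i=\lceil v_i\cdot 2^q\rfloor$ (entrywise rounding to the nearest integer) and sends $\tilde v_i+r_i\in\mathbf{R}$ to the server only; (iii) the server sums the received matrices, samples $\gamma$ with independent $\mathcal{N}(0,s^2)$ entries, adds $\lceil\gamma\cdot 2^q\rfloor$, and broadcasts the result to all clients; (iv) each client subtracts $r$ and divides by $2^q$ to obtain the noisy aggregate.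
   Formalization: Each offset x−μ_j is truncated towards 0 to q fractional bits before a client sums the offsets; with exact real sums rounded only in GlobalMSA the claim is false, since one extra point can move the rounded sum by more than η. *)

theory Defs
  imports "HOL-Probability.Probability" "HOL-Computational_Algebra.Polynomial" "HOL-Library.Word"
begin


section \<open>Probabilistic polynomial time\<close>

text \<open>
  Probabilistic single-tape Turing machines with a finite control, a finite alphabet and one fair
  coin per step.  States 0 and 1 are halting with outputs 0 and 1, state 2 is initial.
  Tape symbols: 0 is blank, 1 and 2 stand for the bits 0 and 1, 3 is a separator.
\<close>

record ptm =
  num_states :: nat
  num_symbols :: nat
  transition :: "bool \<Rightarrow> nat \<Rightarrow> nat \<Rightarrow> nat \<times> nat \<times> int"  \<comment> \<open>coin, state, scanned symbol\<close>

definition wf_ptm :: "ptm \<Rightarrow> bool" where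
  "wf_ptm A \<longleftrightarrow> 3 \<le> num_states A \<and> 4 \<le> num_symbols A \<and>
     (\<forall>c. \<forall>p < num_states A. \<forall>a < num_symbols A.
        case transition A c p a of (p', a', m) \<Rightarrow>
          p' < num_states A \<and> a' < num_symbols A \<and> m \<in> {-1, 0, 1})"

type_synonym config = "nat \<times> (int \<Rightarrow> nat) \<times> int"

fun ptm_step :: "ptm \<Rightarrow> bool \<Rightarrow> config \<Rightarrow> config" where
  "ptm_step A c (p, tape, h) =
     (if p \<in> {0, 1} then (p, tape, h)
      else case transition A c p (tape h) of (p', a, m) \<Rightarrow> (p', tape(h := a), h + m))"

text \<open>The input consists of the security parameter in unary and a bit string.\<close>

definition initial_config :: "nat \<Rightarrow> bool list \<Rightarrow> config" where
  "initial_config n x =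
     (let w = replicate n 2 @ [3] @ map (\<lambda>b. if b then 2 else 1) x
      in (2, \<lambda>i. if 0 \<le> i \<and> i < int (length w) then w ! nat i else 0, 0))"

definition final_state :: "ptm \<Rightarrow> nat \<Rightarrow> bool list \<Rightarrow> bool list \<Rightarrow> nat" where
  "final_state A n x coins = fst (fold (ptm_step A) coins (initial_config n x))"

text \<open>
  The running time is bounded by a polynomial in the security parameter, for every input and all
  coin tosses.
\<close>

definition ppt :: "ptm \<Rightarrow> nat poly \<Rightarrow> bool" where
  "ppt A p \<longleftrightarrow> wf_ptm A \<and>
     (\<forall>n x coins. length coins = poly p n \<longrightarrow> final_state A n x coins \<in> {0, 1})"

definition uniform_bits :: "nat \<Rightarrow> bool list pmf" where
  "uniform_bits n = pmf_of_set {s. length s = n}"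

definition decision :: "ptm \<Rightarrow> nat poly \<Rightarrow> nat \<Rightarrow> bool list \<Rightarrow> bool pmf" where
  "decision A p n x = map_pmf (\<lambda>coins. final_state A n x coins = 1) (uniform_bits (poly p n))"

definition negligible :: "(nat \<Rightarrow> real) \<Rightarrow> bool" where
  "negligible \<nu> \<longleftrightarrow> (\<forall>c. \<nu> \<in> o(\<lambda>n. 1 / real n ^ c))"

text \<open>
  A generator expands a seed, whose length is the security parameter, into a bit stream, of which
  every prefix of polynomial length has to be pseudorandom.  Computability of the generator in
  polynomial time is not demanded; being an assumption on the generator, it could only restrict
  the generators for which a security theorem speaks.
\<close>

definition secure_prng :: "(bool list \<Rightarrow> nat \<Rightarrow> bool) \<Rightarrow> bool" where
  "secure_prng G \<longleftrightarrow> (\<forall>A p l. ppt A p \<longrightarrow> negligible (\<lambda>n.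
     \<bar>pmf (do { s \<leftarrow> uniform_bits n; decision A p n (map (G s) [0..<poly l n]) }) True
      - pmf (do { u \<leftarrow> uniform_bits (poly l n); decision A p n u }) True\<bar>))"


section \<open>Computational differential privacy of multi-party protocols\<close>

datatype party = Server | Client nat

definition parties :: "nat \<Rightarrow> party set" where
  "parties M = insert Server (Client ` {..<M})"

fun own_data :: "party \<Rightarrow> (nat \<Rightarrow> 'x multiset) \<Rightarrow> 'x multiset" where
  "own_data Server D = {#}"
| "own_data (Client a) D = D a"

definition honest_data :: "nat \<Rightarrow> party \<Rightarrow> (nat \<Rightarrow> 'x multiset) \<Rightarrow> 'x multiset" where
  "honest_data M P D = (\<Sum>i\<in>{i. i < M \<and> Client i \<noteq> P}. D i)"

definition neighbouring :: "'x set \<Rightarrow> 'x multiset \<Rightarrow> 'x multiset \<Rightarrow> bool" where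
  "neighbouring X U U' \<longleftrightarrow> (\<exists>x\<in>X. U' = add_mset x U \<or> U = add_mset x U')"

text \<open>
  A protocol is given by the distribution of the view of each party, depending on the security
  parameter and on the datasets of the clients; \<open>enc\<close> encodes views as bit strings.  The adversary
  controlling party \<open>P\<close> is run on the encoded view followed by a representation of its own dataset.
  As the data may be real vectors, which no bit string determines, privacy is demanded for every
  choice \<open>repr\<close> of representation, of a precision that may grow with the security parameter.
  Data neighbouring on the level of unions may be distributed among the honest clients arbitrarily.
\<close>

definition ind_cdp_mpc ::
  "nat \<Rightarrow> 'x set \<Rightarrow> ('v \<Rightarrow> bool list) \<Rightarrow> (party \<Rightarrow> nat \<Rightarrow> (nat \<Rightarrow> 'x multiset) \<Rightarrow> 'v pmf) \<Rightarrow>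
   (nat \<Rightarrow> real) \<Rightarrow> real \<Rightarrow> bool" where
  "ind_cdp_mpc M X enc view \<epsilon> \<delta> \<longleftrightarrow>
     (\<forall>P \<in> parties M. \<forall>A p. \<forall>repr :: nat \<Rightarrow> 'x multiset \<Rightarrow> bool list. ppt A p \<longrightarrow>
       (\<exists>\<nu>. negligible \<nu> \<and>
         (\<forall>n D D'.
            (\<forall>i<M. set_mset (D i) \<subseteq> X \<and> set_mset (D' i) \<subseteq> X) \<and>
            own_data P D = own_data P D' \<and>
            neighbouring X (honest_data M P D) (honest_data M P D') \<longrightarrow>
            pmf (do { v \<leftarrow> view P n D; decision A p n (enc v @ repr n (own_data P D)) }) True
            \<le> exp (\<epsilon> n) *
              pmf (do { v \<leftarrow> view P n D'; decision A p n (enc v @ repr n (own_data P D')) }) True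
              + \<nu> n + \<delta>)))"


section \<open>Noise\<close>

definition std_normal_cdf :: "real \<Rightarrow> real" where
  "std_normal_cdf = cdf std_normal_distribution"

definition gauss_delta :: "real \<Rightarrow> real \<Rightarrow> real" where
  "gauss_delta \<epsilon> \<theta> =
     std_normal_cdf (- \<epsilon> / \<theta> + \<theta> / 2) - exp \<epsilon> * std_normal_cdf (- \<epsilon> / \<theta> - \<theta> / 2)"

definition calibrated :: "real \<Rightarrow> real \<Rightarrow> real \<Rightarrow> bool" where
  "calibrated \<epsilon> \<delta> \<sigma> \<longleftrightarrow>
     (let S = {\<sigma>. 0 < \<sigma> \<and> gauss_delta \<epsilon> (1 / \<sigma>) \<le> \<delta>} in \<sigma> \<in> S \<and> (\<forall>\<sigma>'\<in>S. \<sigma> \<le> \<sigma>'))"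

definition sigma_R :: "nat \<Rightarrow> real \<Rightarrow> real" where
  "sigma_R d \<sigma> = \<sigma> * sqrt (1 + sqrt (4 * real d)) / root 4 (4 * real d)"

definition sigma_C :: "nat \<Rightarrow> real \<Rightarrow> real" where
  "sigma_C d \<sigma> = \<sigma> * sqrt (1 + sqrt (4 * real d))"

text \<open>The distribution of \<open>round (\<gamma> * 2 ^ q)\<close> for \<open>\<gamma>\<close> normal with mean 0 and deviation \<open>s\<close>.\<close>

definition rounded_normal :: "real \<Rightarrow> nat \<Rightarrow> int pmf" where
  "rounded_normal s q =
     embed_pmf (\<lambda>z. measure (density lborel (normal_density 0 s)) {\<gamma>. round (\<gamma> * 2 ^ q) = z})"

lemma measure_pmf_rounded_normal:
  assumes "0 < s"
  shows "measure_pmf (rounded_normal s q) =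
    distr (density lborel (normal_density 0 s)) (count_space UNIV) (\<lambda>\<gamma>. round (\<gamma> * 2 ^ q))"
proof -
  let ?N = "density lborel (normal_density 0 s)"
  let ?f = "\<lambda>\<gamma>::real. round (\<gamma> * 2 ^ q) :: int"
  let ?D = "distr ?N (count_space UNIV) ?f"
  interpret N: prob_space ?N
    using assms by (rule prob_space_normal_density)
  have f [measurable]: "?f \<in> borel \<rightarrow>\<^sub>M count_space UNIV"
    unfolding round_def by measurable
  interpret D: prob_space ?D
    by (rule N.prob_space_distr) simp
  have eq: "measure ?N {\<gamma>. ?f \<gamma> = z} = measure ?D {z}" for z
    by (subst measure_distr) (auto simp: vimage_def)
  have "(\<integral>\<^sup>+z. emeasure ?D {z} \<partial>count_space UNIV) = emeasure ?D (\<Union>z\<in>UNIV. {z})"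
    by (rule emeasure_UN_countable [symmetric]) (auto simp: disjoint_family_on_def)
  also have "\<dots> = 1"
    using D.emeasure_space_1 by simp
  finally have "(\<integral>\<^sup>+z. ennreal (measure ?N {\<gamma>. ?f \<gamma> = z}) \<partial>count_space UNIV) = 1"
    by (simp add: eq D.emeasure_eq_measure)
  then have pmf: "pmf (rounded_normal s q) z = measure ?D {z}" for z
    unfolding rounded_normal_def eq [symmetric] by (intro pmf_embed_pmf) auto
  show ?thesis
  proof (rule measure_eqI_countable [of _ UNIV])
    show "emeasure (measure_pmf (rounded_normal s q)) {z} = emeasure ?D {z}" for z
      by (simp add: emeasure_pmf_single pmf D.emeasure_eq_measure)
  qed auto
qed


section \<open>Masked secure aggregation\<close>

text \<open>
  Matrices are flattened to lists.  The ring of integers modulo \<open>2 ^ w\<close> is \<^typ>\<open>'w::len word\<close> with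
  \<open>w = LENGTH('w)\<close>.  The result consists of the messages to the server and the broadcast.
\<close>

definition encode_fixed :: "nat \<Rightarrow> real list \<Rightarrow> 'w::len word list" where
  "encode_fixed q = map (\<lambda>x. word_of_int (round (x * 2 ^ q)))"

definition sum_lists :: "nat \<Rightarrow> 'a::comm_monoid_add list list \<Rightarrow> 'a list" where
  "sum_lists l vs = map (\<lambda>e. \<Sum>v\<leftarrow>vs. v ! e) [0..<l]"

definition global_msa ::
  "nat \<Rightarrow> nat \<Rightarrow> real \<Rightarrow> real list list \<Rightarrow> 'w::len word list list \<Rightarrow>
   ('w word list list \<times> 'w word list) pmf" where
  "global_msa q l s vs rs = do {
     let uploads = map2 (map2 (+)) (map (encode_fixed q) vs) rs;
     noise \<leftarrow> replicate_pmf l (rounded_normal s q);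
     return_pmf (uploads, map2 (+) (sum_lists l uploads) (map word_of_int noise))
   }"

text \<open>Unmasking by the clients; ring elements are read as signed numbers.\<close>

definition unmask :: "nat \<Rightarrow> nat \<Rightarrow> 'w::len word list list \<Rightarrow> 'w word list \<Rightarrow> real list" where
  "unmask q l rs b = map2 (\<lambda>y r. real_of_int (sint (y - r)) / 2 ^ q) b (sum_lists l rs)"


section \<open>FastLloyd\<close>

record 'd fastlloyd =
  clients :: nat
  clusters :: nat
  iterations :: nat
  radius :: real
  bound :: real
  precision :: nat
  prng :: "bool list \<Rightarrow> nat \<Rightarrow> bool"
  init_bits :: nat    \<comment> \<open>number of pseudorandom bits consumed by the initialization\<close>
  init :: "bool list \<Rightarrow> nat \<Rightarrow> real ^ 'd"

definition data_box :: "real \<Rightarrow> (real ^ 'd) set" where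
  "data_box B = {x. \<forall>c. - B \<le> x $ c \<and> x $ c \<le> B}"

text \<open>Ties are broken in favour of the smallest index.\<close>

definition nearest :: "nat \<Rightarrow> (nat \<Rightarrow> real ^ 'd::finite) \<Rightarrow> real ^ 'd \<Rightarrow> nat" where
  "nearest k \<mu> x = (LEAST j. j < k \<and> (\<forall>j'<k. dist x (\<mu> j) \<le> dist x (\<mu> j')))"

definition assigned ::
  "'d::finite fastlloyd \<Rightarrow> (nat \<Rightarrow> real ^ 'd) \<Rightarrow> (real ^ 'd) multiset \<Rightarrow> nat \<Rightarrow> (real ^ 'd) multiset"
where
  "assigned prot \<mu> D j =
     filter_mset (\<lambda>x. nearest (clusters prot) \<mu> x = j \<and> dist x (\<mu> j) < radius prot) D"

text \<open>
  Clients accumulate the offsets from the centroid in fixed-point arithmetic: each offset is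
  truncated towards 0 to \<open>q\<close> fractional bits, which does not increase its norm.  Were the sum of the
  exact real offsets rounded instead, an additional data point could change the result by more
  than the radius, and noise calibrated to the radius would not suffice.
\<close>

definition fixed_point :: "nat \<Rightarrow> real ^ 'd \<Rightarrow> real ^ 'd" where
  "fixed_point q x = (\<chi> c. sgn (x $ c) * of_int \<lfloor>\<bar>x $ c\<bar> * 2 ^ q\<rfloor> / 2 ^ q)"

definition local_sum ::
  "'d::finite fastlloyd \<Rightarrow> (nat \<Rightarrow> real ^ 'd) \<Rightarrow> (real ^ 'd) multiset \<Rightarrow> nat \<Rightarrow> real ^ 'd" where
  "local_sum prot \<mu> D j = (\<Sum>x\<in>#assigned prot \<mu> D j. fixed_point (precision prot) (x - \<mu> j))"

definition local_count ::
  "'d::finite fastlloyd \<Rightarrow> (nat \<Rightarrow> real ^ 'd) \<Rightarrow> (real ^ 'd) multiset \<Rightarrow> nat \<Rightarrow> real" where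
  "local_count prot \<mu> D j = real (size (assigned prot \<mu> D j))"

definition flatten :: "nat \<Rightarrow> (nat \<Rightarrow> real ^ 'd::finite) \<Rightarrow> real list" where
  "flatten k R =
     concat (map (\<lambda>j. map (\<lambda>c. R j $ from_nat_into UNIV c) [0..<CARD('d)]) [0..<k])"

definition unflatten :: "real list \<Rightarrow> nat \<Rightarrow> real ^ 'd::finite" where
  "unflatten xs j = (\<chi> c. xs ! (j * CARD('d) + to_nat_on UNIV c))"

text \<open>Reflection over the boundary of the interval, repeated as often as necessary.\<close>

definition reflect :: "real \<Rightarrow> real \<Rightarrow> real" where
  "reflect B y = (let z = 4 * B * frac ((y + B) / (4 * B)) in if z \<le> 2 * B then z - B else 3 * B - z)"

definition post_process ::
  "'d::finite fastlloyd \<Rightarrow> real ^ 'd \<Rightarrow> real \<Rightarrow> real ^ 'd \<Rightarrow> real ^ 'd" where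
  "post_process prot R C \<mu> =
     (let \<nu> = (1 / C) *\<^sub>R R + \<mu>;
          \<nu>' = (if dist \<nu> \<mu> > radius prot then \<mu> + (radius prot / dist \<nu> \<mu>) *\<^sub>R (\<nu> - \<mu>) else \<nu>)
      in \<chi> c. reflect (bound prot) (\<nu>' $ c))"

text \<open>
  The stream obtained from the shared seed is consumed as follows: first the bits of the
  initialization, then, for every iteration and every client, one ring element for each of the
  \<open>k * d + k\<close> entries of the two matrices.
\<close>

definition mask_word :: "'d::finite fastlloyd \<Rightarrow> (nat \<Rightarrow> bool) \<Rightarrow> nat \<Rightarrow> 'w::len word" where
  "mask_word prot g m =
     horner_sum of_bool 2 (map (\<lambda>b. g (init_bits prot + m * LENGTH('w) + b)) [0..<LENGTH('w)])"

definition mask_entry :: "'d::finite fastlloyd \<Rightarrow> (nat \<Rightarrow> bool) \<Rightarrow> nat \<Rightarrow> nat \<Rightarrow> nat \<Rightarrow> 'w::len word" where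
  "mask_entry prot g t i e =
     mask_word prot g ((t * clients prot + i) * (clusters prot * CARD('d) + clusters prot) + e)"

definition masks_R :: "'d::finite fastlloyd \<Rightarrow> (nat \<Rightarrow> bool) \<Rightarrow> nat \<Rightarrow> 'w::len word list list" where
  "masks_R prot g t =
     map (\<lambda>i. map (mask_entry prot g t i) [0..<clusters prot * CARD('d)]) [0..<clients prot]"

definition masks_C :: "'d::finite fastlloyd \<Rightarrow> (nat \<Rightarrow> bool) \<Rightarrow> nat \<Rightarrow> 'w::len word list list" where
  "masks_C prot g t =
     map (\<lambda>i. map (\<lambda>j. mask_entry prot g t i (clusters prot * CARD('d) + j)) [0..<clusters prot]) [0..<clients prot]"

text \<open>
  Given the stream \<open>g\<close>, the centroids after \<open>t\<close> iterations and the list of the messages exchanged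
  in the invocations of the aggregation.
\<close>

primrec run ::
  "'d::finite fastlloyd \<Rightarrow> real \<Rightarrow> (nat \<Rightarrow> bool) \<Rightarrow> (nat \<Rightarrow> (real ^ 'd) multiset) \<Rightarrow> nat \<Rightarrow>
   ((nat \<Rightarrow> real ^ 'd) \<times> ('w::len word list list \<times> 'w word list) list) pmf" where
  "run prot \<sigma> g D 0 = return_pmf (init prot (map g [0..<init_bits prot]), [])"
| "run prot \<sigma> g D (Suc t) = do {
     (\<mu>, tr) \<leftarrow> run prot \<sigma> g D t;
     let k = clusters prot;
     let d = CARD('d);
     let q = precision prot;
     let T = real (iterations prot);
     let Rs = map (\<lambda>i. flatten k (local_sum prot \<mu> (D i))) [0..<clients prot];
     let Cs = map (\<lambda>i. map (local_count prot \<mu> (D i)) [0..<k]) [0..<clients prot];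
     (uR, bR) \<leftarrow> global_msa q (k * d) (sigma_R d \<sigma> * radius prot * sqrt T) Rs (masks_R prot g t);
     (uC, bC) \<leftarrow> global_msa q k (sigma_C d \<sigma> * sqrt T) Cs (masks_C prot g t);
     let R = unflatten (unmask q (k * d) (masks_R prot g t) bR);
     let C = (!) (unmask q k (masks_C prot g t) bC);
     return_pmf (\<lambda>j. post_process prot (R j) (C j) (\<mu> j), tr @ [(uR, bR), (uC, bC)])
   }"

text \<open>
  A view consists of the shared seed, if known to the party, and of all messages sent or received
  by the party.
\<close>

type_synonym 'w view = "bool list \<times> 'w word list list"

fun observed ::
  "party \<Rightarrow> bool list \<Rightarrow> ('w word list list \<times> 'w word list) list \<Rightarrow> 'w view" where
  "observed Server s tr = ([], concat (map (\<lambda>(u, b). u @ [b]) tr))"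
| "observed (Client a) s tr = (s, concat (map (\<lambda>(u, b). [u ! a, b]) tr))"

definition encode_view :: "'w::len view \<Rightarrow> bool list" where
  "encode_view = (\<lambda>(s, ms). s @ concat (map (\<lambda>y. map (bit y) [0..<LENGTH('w)]) (concat ms)))"

definition fastlloyd_view ::
  "'d::finite fastlloyd \<Rightarrow> (nat \<Rightarrow> real) \<Rightarrow> party \<Rightarrow> nat \<Rightarrow> (nat \<Rightarrow> (real ^ 'd) multiset) \<Rightarrow>
   'w::len view pmf" where
  "fastlloyd_view prot \<sigma> P n D = do {
     s \<leftarrow> uniform_bits n;
     (\<mu>, tr) \<leftarrow> run prot (\<sigma> n) (prng prot s) D (iterations prot);
     return_pmf (observed P s tr)
   }"

end

theory Submission
  imports Defs
begin

text \<open>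
  The masks hide the uploads from the server. The number of pseudorandom bits consumed does not
  depend on the security parameter, so a machine that compares its input with a fixed string suffices to
  show that these bits are statistically close to uniform. With uniform masks the
  uploads are uniform whatever the centroids are, and the server's view does not depend on the data.

  A client sees, up to a function of its own data and of the seed, only sums of integers with
  rounded Gaussian noise, that is, a rounding of the Gaussian mechanism. Adaptive composition is
  exact in terms of the hockey-stick divergence between \<open>N(\<theta>, 1)\<close> and \<open>N(0, 1)\<close>, with \<open>\<theta>\<^sup>2\<close>
  additive. One data point changes one cluster only, by at most \<open>\<eta>\<close> in the offsets and by 1 in the
  counts, so an iteration contributes \<open>1 / (T \<sigma>\<^sup>2)\<close> and the whole run \<open>\<theta> = 1 / \<sigma>\<close>.
\<close>

section \<open>Gaussian hockey-stick divergence\<close>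

text \<open>The value \<open>\<sigma>\<close> is calibrated tightly for a single Gaussian mechanism,
  so nothing may be lost over the rounds: adding up pairs (eps, delta) would be too coarse. Hence a
  whole curve is carried along, the divergence at every order c. Conditioning on an output x of the
  first stage turns the order c into c Q(x) / P(x), which varies with x; the Gaussian curves are
  closed under this operation because independent normal variables add in variance. Rounded noise
  makes every view a discrete distribution, while the curve is an integral over the real line; the
  integrals are interchanged over countable supports. The comparison with Gaussians takes place over
  the integers, and masking, reduction modulo 2^w and post-processing of centroids are applied
  afterwards as common maps. The constants in \<open>sigma_R\<close> and \<open>sigma_C\<close>
  split the budget of a round between offsets and counts in the ratio sqrt(4d) : 1.\<close>

lemma nn_integral_std_normal_scale:
  assumes [measurable]: "h \<in> borel_measurable borel" and "0 < a"
  shows "(\<integral>\<^sup>+z. h (a * z) \<partial>std_normal_distribution)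
    = (\<integral>\<^sup>+x. ennreal (normal_density 0 a x) * h x \<partial>lborel)"
proof -
  have "(\<integral>\<^sup>+x. ennreal (normal_density 0 a x) * h x \<partial>lborel)
      = \<bar>a\<bar> * (\<integral>\<^sup>+z. ennreal (normal_density 0 a (a * z)) * h (a * z) \<partial>lborel)"
    using \<open>0 < a\<close> by (subst nn_integral_real_affine [where c = a and t = 0]) auto
  also have "\<dots> = (\<integral>\<^sup>+z. ennreal a * (ennreal (normal_density 0 a (a * z)) * h (a * z)) \<partial>lborel)"
    using \<open>0 < a\<close> by (subst nn_integral_cmult) auto
  also have "\<dots> = (\<integral>\<^sup>+z. ennreal (std_normal_density z) * h (a * z) \<partial>lborel)"
    using \<open>0 < a\<close>
    by (intro nn_integral_cong)
      (simp add: mult.assoc [symmetric] ennreal_mult [symmetric] normal_density_def real_sqrt_mult power_mult_distrib)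
  also have "\<dots> = (\<integral>\<^sup>+z. h (a * z) \<partial>std_normal_distribution)"
    by (subst nn_integral_density) auto
  finally show ?thesis by simp
qed

text \<open>Convolution of two normal densities adds the variances. A weight 0 has no normal density
  and is treated apart; it does occur, since a stage that is the same on both sides is composed with
  parameter 0.\<close>

lemma nn_integral_std_normal_add:
  assumes [measurable]: "h \<in> borel_measurable borel" and "0 \<le> a" "0 \<le> b"
  shows "(\<integral>\<^sup>+z. \<integral>\<^sup>+w. h (a * z + b * w) \<partial>std_normal_distribution \<partial>std_normal_distribution)
    = (\<integral>\<^sup>+z. h (sqrt (a\<^sup>2 + b\<^sup>2) * z) \<partial>std_normal_distribution)"
proof -
  interpret N: prob_space std_normal_distribution
    by (rule prob_space_normal_density) simp
  consider "a = 0" | "b = 0" | "0 < a" "0 < b" using assms by linarith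
  then show ?thesis
  proof cases
    case 1
    then show ?thesis using \<open>0 \<le> b\<close> N.emeasure_space_1 by simp
  next
    case 2
    then show ?thesis using \<open>0 \<le> a\<close> N.emeasure_space_1 by simp
  next
    case 3
    let ?n = "\<lambda>s x. ennreal (normal_density 0 s x)"
    let ?s = "sqrt (a\<^sup>2 + b\<^sup>2)"
    have s: "0 < ?s" using 3 by (simp add: add_pos_pos)
    have "(\<integral>\<^sup>+z. \<integral>\<^sup>+w. h (a * z + b * w) \<partial>std_normal_distribution \<partial>std_normal_distribution)
        = (\<integral>\<^sup>+z. \<integral>\<^sup>+y. ?n b y * h (a * z + y) \<partial>lborel \<partial>std_normal_distribution)"
      by (subst nn_integral_std_normal_scale [OF _ \<open>0 < b\<close>]) auto
    also have "\<dots> = (\<integral>\<^sup>+x. ?n a x * (\<integral>\<^sup>+y. ?n b y * h (x + y) \<partial>lborel) \<partial>lborel)"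
      by (subst nn_integral_std_normal_scale [OF _ \<open>0 < a\<close>, symmetric]) auto
    also have "\<dots> = (\<integral>\<^sup>+x. \<integral>\<^sup>+y. ?n a x * (?n b y * h (x + y)) \<partial>lborel \<partial>lborel)"
      by (simp add: nn_integral_cmult)
    also have "\<dots> = (\<integral>\<^sup>+y. \<integral>\<^sup>+x. ?n a x * (?n b y * h (x + y)) \<partial>lborel \<partial>lborel)"
      by (rule lborel_pair.Fubini') measurable
    also have "\<dots> = (\<integral>\<^sup>+y. \<integral>\<^sup>+u. ?n a (u - y) * (?n b y * h u) \<partial>lborel \<partial>lborel)"
    proof (rule nn_integral_cong)
      fix y
      show "(\<integral>\<^sup>+x. ?n a x * (?n b y * h (x + y)) \<partial>lborel) = (\<integral>\<^sup>+u. ?n a (u - y) * (?n b y * h u) \<partial>lborel)"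
        by (subst nn_integral_real_affine [where c = 1 and t = "-y"]) (auto simp: algebra_simps)
    qed
    also have "\<dots> = (\<integral>\<^sup>+u. \<integral>\<^sup>+y. ?n a (u - y) * (?n b y * h u) \<partial>lborel \<partial>lborel)"
      by (rule lborel_pair.Fubini') measurable
    also have "\<dots> = (\<integral>\<^sup>+u. (\<integral>\<^sup>+y. ennreal (normal_density 0 a (u - y) * normal_density 0 b y) \<partial>lborel) * h u \<partial>lborel)"
      by (simp add: nn_integral_multc [symmetric] ennreal_mult mult.assoc)
    also have "\<dots> = (\<integral>\<^sup>+u. ?n ?s u * h u \<partial>lborel)"
      using fun_cong [OF conv_normal_density_zero_mean [OF 3]] by simp
    also have "\<dots> = (\<integral>\<^sup>+z. h (?s * z) \<partial>std_normal_distribution)"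
      using s by (simp add: nn_integral_std_normal_scale)
    finally show ?thesis .
  qed
qed

text \<open>
  The hockey-stick divergence of order \<open>c\<close> between \<open>N(\<theta>, 1)\<close> and \<open>N(0, 1)\<close>, where \<open>v = \<theta>\<^sup>2\<close>:
  under \<open>N(0, 1)\<close> the likelihood ratio of the two is \<open>exp (\<theta> z - \<theta>\<^sup>2 / 2)\<close>.
\<close>

definition gauss_profile :: "real \<Rightarrow> real \<Rightarrow> ennreal" where
  "gauss_profile v c = (\<integral>\<^sup>+z. ennreal (exp (sqrt v * z - v / 2) - c) \<partial>std_normal_distribution)"

text \<open>Pulling the factor inside turns the product into a difference of order c whose exponent
  is the sum of two log-likelihood ratios, \<open>sqrt w * z + sqrt v * y - (v + w) / 2\<close>; its
  random part is normal with variance v + w. The left side is the expression that composition leaves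
  behind in \<open>gauss_dominated_bind\<close>.\<close>

lemma gauss_profile_add:
  assumes "0 \<le> v" "0 \<le> w"
  shows "(\<integral>\<^sup>+z. ennreal (exp (sqrt w * z - w / 2)) * gauss_profile v (c / exp (sqrt w * z - w / 2))
      \<partial>std_normal_distribution) = gauss_profile (v + w) c"
proof -
  let ?N = std_normal_distribution
  let ?h = "\<lambda>x. ennreal (exp (x - (v + w) / 2) - c)"
  have "(\<integral>\<^sup>+z. ennreal (exp (sqrt w * z - w / 2)) * gauss_profile v (c / exp (sqrt w * z - w / 2)) \<partial>?N)
      = (\<integral>\<^sup>+z. \<integral>\<^sup>+y. ?h (sqrt w * z + sqrt v * y) \<partial>?N \<partial>?N)"
  proof (rule nn_integral_cong)
    fix z
    let ?e = "exp (sqrt w * z - w / 2)"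
    have "ennreal ?e * gauss_profile v (c / ?e)
        = (\<integral>\<^sup>+y. ennreal ?e * ennreal (exp (sqrt v * y - v / 2) - c / ?e) \<partial>?N)"
      unfolding gauss_profile_def by (rule nn_integral_cmult [symmetric]) measurable
    also have "\<dots> = (\<integral>\<^sup>+y. ?h (sqrt w * z + sqrt v * y) \<partial>?N)"
    proof (rule nn_integral_cong)
      fix y
      have "?e * (exp (sqrt v * y - v / 2) - c / ?e) = exp (sqrt w * z + sqrt v * y - (v + w) / 2) - c"
        by (simp add: right_diff_distrib exp_add [symmetric]) (simp add: add_divide_distrib algebra_simps)
      then show "ennreal ?e * ennreal (exp (sqrt v * y - v / 2) - c / ?e) = ?h (sqrt w * z + sqrt v * y)"
        by (subst ennreal_mult' [symmetric]) auto
    qed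
    finally show "ennreal ?e * gauss_profile v (c / ?e) = (\<integral>\<^sup>+y. ?h (sqrt w * z + sqrt v * y) \<partial>?N)" .
  qed
  also have "\<dots> = (\<integral>\<^sup>+z. ?h (sqrt ((sqrt w)\<^sup>2 + (sqrt v)\<^sup>2) * z) \<partial>?N)"
    using assms by (subst nn_integral_std_normal_add) auto
  also have "\<dots> = gauss_profile (v + w) c"
    unfolding gauss_profile_def using assms by (simp add: add.commute)
  finally show ?thesis .
qed

lemma nn_integral_exp_std_normal:
  "(\<integral>\<^sup>+z. ennreal (exp (\<theta> * z - \<theta>\<^sup>2 / 2)) \<partial>std_normal_distribution) = 1"
proof -
  have "(\<integral>\<^sup>+z. ennreal (exp (\<theta> * z - \<theta>\<^sup>2 / 2)) \<partial>std_normal_distribution)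
      = (\<integral>\<^sup>+z. ennreal (normal_density \<theta> 1 z) \<partial>lborel)"
    by (subst nn_integral_density)
      (auto intro!: nn_integral_cong simp: ennreal_mult [symmetric] normal_density_def exp_add [symmetric]
        power2_eq_square field_simps)
  also have "\<dots> = 1"
    using prob_space.emeasure_space_1 [OF prob_space_normal_density [of 1 \<theta>]]
    by (simp add: emeasure_density)
  finally show ?thesis .
qed

text \<open>The likelihood ratio has mean 1, and subtracting c before taking the positive part costs
  at most c. The bound is the divergence of a distribution from itself, so reflexivity of domination
  follows.\<close>

lemma gauss_profile_ge:
  assumes "0 \<le> v" "0 \<le> c"
  shows "ennreal (1 - c) \<le> gauss_profile v c"
proof -
  let ?N = std_normal_distribution
  interpret N: prob_space ?N by (rule prob_space_normal_density) simp
  have "1 = (\<integral>\<^sup>+z. ennreal (exp (sqrt v * z - v / 2)) \<partial>?N)"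
    using nn_integral_exp_std_normal [of "sqrt v"] \<open>0 \<le> v\<close> by simp
  also have "\<dots> \<le> (\<integral>\<^sup>+z. ennreal (exp (sqrt v * z - v / 2) - c) + ennreal c \<partial>?N)"
  proof (rule nn_integral_mono)
    fix z
    have "exp (sqrt v * z - v / 2) \<le> max 0 (exp (sqrt v * z - v / 2) - c) + c" by simp
    then have "ennreal (exp (sqrt v * z - v / 2)) \<le> ennreal (max 0 (exp (sqrt v * z - v / 2) - c) + c)"
      by (rule ennreal_leI)
    then show "ennreal (exp (sqrt v * z - v / 2)) \<le> ennreal (exp (sqrt v * z - v / 2) - c) + ennreal c"
      using \<open>0 \<le> c\<close> by (subst (asm) ennreal_plus) (auto simp: max_def ennreal_neg split: if_splits)
  qed
  also have "\<dots> = gauss_profile v c + ennreal c"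
    unfolding gauss_profile_def using N.emeasure_space_1 by (subst nn_integral_add) auto
  finally have "1 \<le> gauss_profile v c + ennreal c" .
  then have "1 - ennreal c \<le> gauss_profile v c"
    by (simp add: ennreal_minus_le_iff add.commute)
  then show ?thesis
    using \<open>0 \<le> c\<close> by (simp add: ennreal_minus [symmetric])
qed

section \<open>Domination by a Gaussian curve and adaptive composition\<close>

text \<open>Since \<open>ennreal\<close> sends negative numbers to 0, the left side is the
  hockey-stick divergence of order c. All orders are demanded, because composition evaluates both
  stages at orders other than the given one.\<close>

definition gauss_dominated :: "real \<Rightarrow> 'a pmf \<Rightarrow> 'a pmf \<Rightarrow> bool" where
  "gauss_dominated v P Q \<longleftrightarrow>
     (\<forall>c\<ge>0. (\<integral>\<^sup>+x. ennreal (pmf P x - c * pmf Q x) \<partial>count_space UNIV) \<le> gauss_profile v c)"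

lemma gauss_dominated_refl:
  assumes "0 \<le> v"
  shows "gauss_dominated v P P"
  unfolding gauss_dominated_def
proof (intro allI impI)
  fix c :: real assume "0 \<le> c"
  have "(\<integral>\<^sup>+x. ennreal (pmf P x - c * pmf P x) \<partial>count_space UNIV)
      = (\<integral>\<^sup>+x. ennreal (1 - c) * ennreal (pmf P x) \<partial>count_space UNIV)"
    by (intro nn_integral_cong) (simp add: ennreal_mult'' [symmetric] left_diff_distrib)
  also have "\<dots> = ennreal (1 - c)"
    by (subst nn_integral_cmult) (auto simp: nn_integral_pmf)
  also have "\<dots> \<le> gauss_profile v c"
    using assms \<open>0 \<le> c\<close> by (rule gauss_profile_ge)
  finally show "(\<integral>\<^sup>+x. ennreal (pmf P x - c * pmf P x) \<partial>count_space UNIV) \<le> gauss_profile v c" .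
qed

text \<open>Subadditivity of the positive part. It is the data-processing step in two places: for
  the mixture that a bind forms, and for the mass that rounding collects from a cell of the real
  line.\<close>

lemma ennreal_diff_le_nn_integral:
  assumes [measurable]: "f \<in> borel_measurable M" "g \<in> borel_measurable M"
    and p: "ennreal p = (\<integral>\<^sup>+x. ennreal (f x) \<partial>M)" and q: "ennreal q = (\<integral>\<^sup>+x. ennreal (g x) \<partial>M)"
    and "0 \<le> c" "0 \<le> q" "\<And>x. 0 \<le> g x"
  shows "ennreal (p - c * q) \<le> (\<integral>\<^sup>+x. ennreal (f x - c * g x) \<partial>M)"
proof -
  have "ennreal p \<le> (\<integral>\<^sup>+x. ennreal (f x - c * g x) + ennreal c * ennreal (g x) \<partial>M)"
    unfolding p
  proof (rule nn_integral_mono)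
    fix x
    have "ennreal (f x) \<le> ennreal (max 0 (f x - c * g x) + c * g x)"
      by (rule ennreal_leI) simp
    then show "ennreal (f x) \<le> ennreal (f x - c * g x) + ennreal c * ennreal (g x)"
      using assms(5,7) by (subst (asm) ennreal_plus) (auto simp: max_def ennreal_neg ennreal_mult'' split: if_splits)
  qed
  also have "\<dots> = (\<integral>\<^sup>+x. ennreal (f x - c * g x) \<partial>M) + ennreal c * ennreal q"
    unfolding q by (subst nn_integral_add) (auto simp: nn_integral_cmult)
  finally have "ennreal p - ennreal (c * q) \<le> (\<integral>\<^sup>+x. ennreal (f x - c * g x) \<partial>M)"
    using assms(5,6) by (simp add: ennreal_minus_le_iff add.commute ennreal_mult'')
  then show ?thesis
    using assms(5,6) by (simp add: ennreal_minus)
qed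

lemma ennreal_pmf_bind_count_space:
  "ennreal (pmf (bind_pmf P K) y) = (\<integral>\<^sup>+x. ennreal (pmf P x * pmf (K x) y) \<partial>count_space UNIV)"
  by (simp add: ennreal_pmf_bind nn_integral_measure_pmf ennreal_mult)

text \<open>Each stage is exchanged for its Gaussian counterpart in turn: first the kernels, at an
  order depending on x, with the Gaussian variable z in place of their output; then, for fixed z,
  the pair P, Q at order c / L z. The remaining Gaussian integral is
  \<open>gauss_profile_add\<close>.\<close>

lemma gauss_dominated_bind:
  assumes PQ: "gauss_dominated v P Q" and K: "\<And>x. gauss_dominated w (K x) (K' x)"
    and "0 \<le> v" "0 \<le> w"
  shows "gauss_dominated (v + w) (bind_pmf P K) (bind_pmf Q K')"
  unfolding gauss_dominated_def
proof (intro allI impI)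
  fix c :: real assume c: "0 \<le> c"
  let ?N = std_normal_distribution
  let ?I = "set_pmf P"
  \<comment> \<open>The likelihood ratio of N(sqrt w, 1) to N(0, 1).\<close>
  define L where "L z = exp (sqrt w * z - w / 2)" for z
  have L_pos: "0 < L z" for z by (simp add: L_def)
  have [measurable]: "L \<in> borel_measurable borel" unfolding L_def by measurable
  have "(\<integral>\<^sup>+y. ennreal (pmf (bind_pmf P K) y - c * pmf (bind_pmf Q K') y) \<partial>count_space UNIV)
      \<le> (\<integral>\<^sup>+y. \<integral>\<^sup>+x. ennreal (pmf P x * pmf (K x) y - c * (pmf Q x * pmf (K' x) y)) \<partial>count_space UNIV \<partial>count_space UNIV)"
    using c by (intro nn_integral_mono ennreal_diff_le_nn_integral ennreal_pmf_bind_count_space) auto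
  also have "\<dots> = (\<integral>\<^sup>+x. \<integral>\<^sup>+y. ennreal (pmf P x * pmf (K x) y - c * (pmf Q x * pmf (K' x) y)) \<partial>count_space UNIV \<partial>count_space UNIV)"
    using nn_integral_fst_count_space [of "\<lambda>(x, y). ennreal (pmf P x * pmf (K x) y - c * (pmf Q x * pmf (K' x) y))"]
      nn_integral_snd_count_space [of "\<lambda>(x, y). ennreal (pmf P x * pmf (K x) y - c * (pmf Q x * pmf (K' x) y))"]
    by simp
  also have "\<dots> \<le> (\<integral>\<^sup>+x. \<integral>\<^sup>+z. ennreal (pmf P x * L z - c * pmf Q x) \<partial>?N \<partial>count_space UNIV)"
  proof (rule nn_integral_mono)
    fix x
    show "(\<integral>\<^sup>+y. ennreal (pmf P x * pmf (K x) y - c * (pmf Q x * pmf (K' x) y)) \<partial>count_space UNIV)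
        \<le> (\<integral>\<^sup>+z. ennreal (pmf P x * L z - c * pmf Q x) \<partial>?N)"
    proof (cases "pmf P x = 0")
      case True
      then show ?thesis using c by (simp add: ennreal_neg)
    next
      case False
      then have p: "0 < pmf P x" by (simp add: order.not_eq_order_implies_strict)
      \<comment> \<open>The order at which the kernels are compared once x is known; factoring out
        \<open>pmf P x\<close> leaves exactly this multiple of \<open>pmf (K' x) y\<close>.\<close>
      define r where "r = c * pmf Q x / pmf P x"
      have r: "0 \<le> r" "c * pmf Q x = pmf P x * r" using c p by (auto simp: r_def)
      have "(\<integral>\<^sup>+y. ennreal (pmf P x * pmf (K x) y - c * (pmf Q x * pmf (K' x) y)) \<partial>count_space UNIV)
          = (\<integral>\<^sup>+y. ennreal (pmf P x) * ennreal (pmf (K x) y - r * pmf (K' x) y) \<partial>count_space UNIV)"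
        by (intro nn_integral_cong)
          (simp add: ennreal_mult' [symmetric] right_diff_distrib mult.assoc [symmetric] r(2))
      also have "\<dots> = ennreal (pmf P x) * (\<integral>\<^sup>+y. ennreal (pmf (K x) y - r * pmf (K' x) y) \<partial>count_space UNIV)"
        by (rule nn_integral_cmult) auto
      also have "\<dots> \<le> ennreal (pmf P x) * gauss_profile w r"
        using K [of x] r(1) unfolding gauss_dominated_def by (intro mult_left_mono) auto
      also have "\<dots> = (\<integral>\<^sup>+z. ennreal (pmf P x) * ennreal (L z - r) \<partial>?N)"
        unfolding gauss_profile_def L_def by (rule nn_integral_cmult [symmetric]) measurable
      also have "\<dots> = (\<integral>\<^sup>+z. ennreal (pmf P x * L z - c * pmf Q x) \<partial>?N)"
        by (intro nn_integral_cong) (simp add: ennreal_mult' [symmetric] right_diff_distrib r(2))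
      finally show ?thesis .
    qed
  qed
  \<comment> \<open>Outside the support of P the integrand is \<open>ennreal\<close> of a
    nonpositive number, hence 0. The support is countable, which allows the interchange with the
    Gaussian integral.\<close>
  also have "\<dots> = (\<integral>\<^sup>+x. \<integral>\<^sup>+z. ennreal (pmf P x * L z - c * pmf Q x) \<partial>?N \<partial>count_space ?I)"
    using c by (subst (2) nn_integral_count_space_indicator)
      (auto intro!: nn_integral_cong simp: indicator_def ennreal_neg set_pmf_iff)
  also have "\<dots> = (\<integral>\<^sup>+z. \<integral>\<^sup>+x. ennreal (pmf P x * L z - c * pmf Q x) \<partial>count_space ?I \<partial>?N)"
    by (rule nn_integral_count_space_nn_integral [symmetric]) auto
  also have "\<dots> \<le> (\<integral>\<^sup>+z. ennreal (L z) * gauss_profile v (c / L z) \<partial>?N)"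
  proof (rule nn_integral_mono)
    fix z
    have "(\<integral>\<^sup>+x. ennreal (pmf P x * L z - c * pmf Q x) \<partial>count_space ?I)
        \<le> (\<integral>\<^sup>+x. ennreal (pmf P x * L z - c * pmf Q x) \<partial>count_space UNIV)"
      by (subst nn_integral_count_space_indicator) (auto intro!: nn_integral_mono simp: indicator_def)
    also have "\<dots> = (\<integral>\<^sup>+x. ennreal (L z) * ennreal (pmf P x - c / L z * pmf Q x) \<partial>count_space UNIV)"
      using L_pos [of z]
      by (intro nn_integral_cong) (simp add: ennreal_mult' [symmetric] right_diff_distrib mult.commute)
    also have "\<dots> = ennreal (L z) * (\<integral>\<^sup>+x. ennreal (pmf P x - c / L z * pmf Q x) \<partial>count_space UNIV)"
      by (rule nn_integral_cmult) auto
    also have "\<dots> \<le> ennreal (L z) * gauss_profile v (c / L z)"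
      using PQ [unfolded gauss_dominated_def, rule_format, of "c / L z"] c L_pos [of z]
      by (intro mult_left_mono) (auto simp: less_imp_le)
    finally show "(\<integral>\<^sup>+x. ennreal (pmf P x * L z - c * pmf Q x) \<partial>count_space ?I)
        \<le> ennreal (L z) * gauss_profile v (c / L z)" .
  qed
  also have "\<dots> = gauss_profile (v + w) c"
    unfolding L_def using assms(3,4) by (rule gauss_profile_add)
  finally show "(\<integral>\<^sup>+y. ennreal (pmf (bind_pmf P K) y - c * pmf (bind_pmf Q K') y) \<partial>count_space UNIV)
      \<le> gauss_profile (v + w) c" .
qed


text \<open>Data processing as a special case of composition: a common kernel contributes the
  parameter 0.\<close>

lemma gauss_dominated_bind_same:
  assumes "gauss_dominated v P Q" "0 \<le> v"
  shows "gauss_dominated v (bind_pmf P K) (bind_pmf Q K)"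
  using gauss_dominated_bind [OF assms(1) gauss_dominated_refl [of 0] assms(2), of K] by simp

lemma gauss_dominated_map:
  assumes "gauss_dominated v P Q" "0 \<le> v"
  shows "gauss_dominated v (map_pmf f P) (map_pmf f Q)"
  unfolding map_pmf_def using assms by (rule gauss_dominated_bind_same)

text \<open>Monotonicity comes from composition too: \<open>return_pmf\<close> is dominated by
  itself with the slack w - v, and binding it changes neither distribution.\<close>

lemma gauss_dominated_mono:
  assumes "gauss_dominated v P Q" "0 \<le> v" "v \<le> w"
  shows "gauss_dominated w P Q"
  using gauss_dominated_bind [OF assms(1) gauss_dominated_refl [of "w - v"], of return_pmf] assms(2,3)
  by (simp add: bind_return_pmf')

section \<open>From the curve to the calibration condition\<close>

text \<open>One summand of the divergence is at most the whole sum. A single point suffices because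
  the adversary's decision is one Boolean.\<close>

lemma pmf_le_gauss_profile:
  assumes "gauss_dominated v P Q" "0 \<le> c" "gauss_profile v c \<le> ennreal \<delta>" "0 \<le> \<delta>"
  shows "pmf P x \<le> c * pmf Q x + \<delta>"
proof -
  have "ennreal (pmf P x - c * pmf Q x)
      = (\<integral>\<^sup>+y. ennreal (pmf P y - c * pmf Q y) * indicator {x} y \<partial>count_space UNIV)"
    by simp
  also have "\<dots> \<le> (\<integral>\<^sup>+y. ennreal (pmf P y - c * pmf Q y) \<partial>count_space UNIV)"
    by (intro nn_integral_mono) (auto simp: indicator_def)
  also have "\<dots> \<le> ennreal \<delta>"
    using assms unfolding gauss_dominated_def by (blast intro: order_trans)
  finally show ?thesis
    using \<open>0 \<le> \<delta>\<close> by (auto simp: ennreal_le_iff2)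
qed

text \<open>The reflection x -> \<open>\<mu>\<close> - x carries this upper tail to a lower tail of
  the standard normal distribution.\<close>

lemma emeasure_normal_atLeast:
  "emeasure (density lborel (normal_density \<mu> 1)) {b..} = ennreal (std_normal_cdf (\<mu> - b))"
proof -
  interpret N: prob_space std_normal_distribution
    by (rule prob_space_normal_density) simp
  have "emeasure (density lborel (normal_density \<mu> 1)) {b..}
      = (\<integral>\<^sup>+x. ennreal (normal_density \<mu> 1 x) * indicator {b..} x \<partial>lborel)"
    by (subst emeasure_density) auto
  also have "\<dots> = (\<integral>\<^sup>+x. ennreal (std_normal_density x) * indicator {..\<mu> - b} x \<partial>lborel)"
    by (subst nn_integral_real_affine [where c = "-1" and t = \<mu>])
      (auto intro!: nn_integral_cong simp: normal_density_def indicator_def)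
  also have "\<dots> = emeasure std_normal_distribution {..\<mu> - b}"
    by (subst emeasure_density) auto
  finally show ?thesis
    by (simp add: std_normal_cdf_def cdf_def N.emeasure_eq_measure)
qed

text \<open>The likelihood ratio reaches exp eps exactly at the threshold \<open>b\<close>, so the
  positive part restricts to a half-line, and two Gaussian tails remain. This identifies the curve
  at order exp eps with the quantity that the calibration bounds.\<close>

lemma gauss_profile_exp:
  assumes "0 < \<theta>"
  shows "gauss_profile (\<theta>\<^sup>2) (exp \<epsilon>) = ennreal (gauss_delta \<epsilon> \<theta>)"
proof -
  let ?N = std_normal_distribution
  define b where "b = \<epsilon> / \<theta> + \<theta> / 2"
  have pos_iff: "exp \<epsilon> \<le> exp (\<theta> * z - \<theta>\<^sup>2 / 2) \<longleftrightarrow> b \<le> z" for z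
    using \<open>0 < \<theta>\<close> by (simp add: b_def field_simps power2_eq_square)
  have dens: "std_normal_density z * exp (\<theta> * z - \<theta>\<^sup>2 / 2) = normal_density \<theta> 1 z" for z
    by (simp add: normal_density_def exp_add [symmetric] power2_eq_square field_simps)
  \<comment> \<open>The subtracted tail is added to both sides, so that the extended integrals are
    only ever added; the subtraction happens at the end, between finite values.\<close>
  have split: "ennreal (exp (\<theta> * z - \<theta>\<^sup>2 / 2) - exp \<epsilon>) + ennreal (exp \<epsilon>) * indicator {b..} z
      = ennreal (exp (\<theta> * z - \<theta>\<^sup>2 / 2)) * indicator {b..} z" for z
  proof (cases "b \<le> z")
    case True
    then have "0 \<le> exp (\<theta> * z - \<theta>\<^sup>2 / 2) - exp \<epsilon>" using pos_iff by simp
    from ennreal_plus [OF this, of "exp \<epsilon>"] show ?thesis using True by simp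
  next
    case False
    then show ?thesis using pos_iff [of z] by (simp add: ennreal_neg)
  qed
  have "gauss_profile (\<theta>\<^sup>2) (exp \<epsilon>) + ennreal (exp \<epsilon>) * emeasure ?N {b..}
      = (\<integral>\<^sup>+z. ennreal (exp (\<theta> * z - \<theta>\<^sup>2 / 2) - exp \<epsilon>) + ennreal (exp \<epsilon>) * indicator {b..} z \<partial>?N)"
    using \<open>0 < \<theta>\<close> by (subst nn_integral_add) (auto simp: nn_integral_cmult_indicator gauss_profile_def)
  also have "\<dots> = (\<integral>\<^sup>+z. ennreal (exp (\<theta> * z - \<theta>\<^sup>2 / 2)) * indicator {b..} z \<partial>?N)"
    unfolding split ..
  also have "\<dots> = (\<integral>\<^sup>+z. ennreal (normal_density \<theta> 1 z) * indicator {b..} z \<partial>lborel)"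
    by (subst nn_integral_density) (auto simp: mult.assoc [symmetric] ennreal_mult [symmetric] dens)
  also have "\<dots> = emeasure (density lborel (normal_density \<theta> 1)) {b..}"
    by (subst emeasure_density) auto
  finally have *: "gauss_profile (\<theta>\<^sup>2) (exp \<epsilon>) + ennreal (exp \<epsilon> * std_normal_cdf (- b))
      = ennreal (std_normal_cdf (\<theta> - b))"
    by (simp add: emeasure_normal_atLeast ennreal_mult')
  have nonneg: "0 \<le> std_normal_cdf x" for x
    by (simp add: std_normal_cdf_def cdf_def)
  have "gauss_profile (\<theta>\<^sup>2) (exp \<epsilon>) = ennreal (std_normal_cdf (\<theta> - b)) - ennreal (exp \<epsilon> * std_normal_cdf (- b))"
    unfolding * [symmetric] by simp
  also have "\<dots> = ennreal (std_normal_cdf (\<theta> - b) - exp \<epsilon> * std_normal_cdf (- b))"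
    using nonneg by (simp add: ennreal_minus)
  finally show ?thesis
    by (simp add: gauss_delta_def b_def)
qed

text \<open>Dividing by s reduces to unit variance. The curve sees only the square of the shift, so
  a negative shift is reduced by reflecting z.\<close>

lemma nn_integral_normal_hockey_stick:
  assumes "0 < s"
  shows "(\<integral>\<^sup>+x. ennreal (normal_density a s x - c * normal_density 0 s x) \<partial>lborel) = gauss_profile ((a / s)\<^sup>2) c"
proof -
  let ?h = "\<lambda>x. ennreal (exp (a / s * x - (a / s)\<^sup>2 / 2) - c)"
  have dens: "normal_density a s (s * x) - c * normal_density 0 s (s * x)
      = normal_density 0 s (s * x) * (exp (a / s * x - (a / s)\<^sup>2 / 2) - c)" for x
  proof -
    have "- (s * x - a)\<^sup>2 / (2 * s\<^sup>2) = - (s * x)\<^sup>2 / (2 * s\<^sup>2) + (a / s * x - (a / s)\<^sup>2 / 2)"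
      using assms by (simp add: field_simps power2_eq_square)
    then show ?thesis
      unfolding normal_density_def by (simp only: exp_add diff_zero right_diff_distrib) (simp only: ac_simps)
  qed
  have "(\<integral>\<^sup>+x. ennreal (normal_density a s x - c * normal_density 0 s x) \<partial>lborel)
      = (\<integral>\<^sup>+x. ennreal (normal_density 0 s x) * ?h (x / s) \<partial>lborel)"
    using assms dens [of "x / s" for x] by (simp add: ennreal_mult')
  also have "\<dots> = (\<integral>\<^sup>+z. ?h z \<partial>std_normal_distribution)"
    using assms by (subst nn_integral_std_normal_scale [symmetric]) auto
  also have "\<dots> = gauss_profile ((a / s)\<^sup>2) c"
  proof (cases "0 \<le> a")
    case True
    then show ?thesis using assms by (simp add: gauss_profile_def)
  next
    case False
    then have "sqrt ((a / s)\<^sup>2) = - (a / s)" using assms by (simp add: abs_if divide_less_0_iff)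
    have "(\<integral>\<^sup>+z. ?h z \<partial>std_normal_distribution)
        = (\<integral>\<^sup>+z. ennreal (std_normal_density z) * ?h z \<partial>lborel)"
      by (rule nn_integral_density) auto
    also have "\<dots> = (\<integral>\<^sup>+z. ennreal (std_normal_density z) * ?h (- z) \<partial>lborel)"
      by (subst nn_integral_real_affine [where c = "-1" and t = 0]) (auto simp: normal_density_def)
    also have "\<dots> = (\<integral>\<^sup>+z. ?h (- z) \<partial>std_normal_distribution)"
      by (rule nn_integral_density [symmetric]) auto
    also have "\<dots> = gauss_profile ((a / s)\<^sup>2) c"
      unfolding gauss_profile_def \<open>sqrt ((a / s)\<^sup>2) = - (a / s)\<close> by simp
    finally show ?thesis .
  qed
  finally show ?thesis .
qed

section \<open>The rounded Gaussian mechanism\<close>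

text \<open>Rounding commutes with integer shifts: an integer m plus rounded noise is the rounding
  of a normal variable with mean m / 2^q.\<close>

lemma ennreal_pmf_rounded_normal:
  assumes "0 < s"
  shows "ennreal (pmf (rounded_normal s q) (z - m))
    = (\<integral>\<^sup>+x. ennreal (normal_density (real_of_int m / 2 ^ q) s x * indicator {x. round (x * 2 ^ q) = z} x) \<partial>lborel)"
proof -
  let ?N = "density lborel (normal_density 0 s)"
  have [measurable]: "(\<lambda>x::real. round (x * 2 ^ q) :: int) \<in> borel \<rightarrow>\<^sub>M count_space UNIV"
    unfolding round_def by measurable
  have round_shift: "round ((x - real_of_int m / 2 ^ q) * 2 ^ q) = round (x * 2 ^ q) - m" for x :: real
  proof -
    have "(x - real_of_int m / 2 ^ q) * 2 ^ q + 1 / 2 = (x * 2 ^ q + 1 / 2) - real_of_int m"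
      by (simp add: field_simps)
    then show ?thesis by (simp only: round_def floor_diff_of_int)
  qed
  have "ennreal (pmf (rounded_normal s q) (z - m)) = emeasure ?N {x. round (x * 2 ^ q) = z - m}"
    by (simp add: emeasure_pmf_single [symmetric] measure_pmf_rounded_normal [OF assms] emeasure_distr vimage_def)
  also have "\<dots> = (\<integral>\<^sup>+x. ennreal (normal_density 0 s x * indicator {x. round (x * 2 ^ q) = z - m} x) \<partial>lborel)"
    by (subst emeasure_density) (auto simp: ennreal_mult' ennreal_indicator)
  also have "\<dots> = (\<integral>\<^sup>+x. ennreal (normal_density 0 s (x - real_of_int m / 2 ^ q)
      * indicator {x. round (x * 2 ^ q) = z - m} (x - real_of_int m / 2 ^ q)) \<partial>lborel)"
    by (subst nn_integral_real_affine [where c = 1 and t = "- (real_of_int m / 2 ^ q)"]) auto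
  also have "\<dots> = (\<integral>\<^sup>+x. ennreal (normal_density (real_of_int m / 2 ^ q) s x * indicator {x. round (x * 2 ^ q) = z} x) \<partial>lborel)"
    by (intro nn_integral_cong) (simp add: normal_density_def indicator_def round_shift)
  finally show ?thesis .
qed

text \<open>Rounding is post-processing of the real Gaussian mechanism. The rounding cells partition
  the line, so summing the bounds of the cells gives back the full Gaussian integral. Only the
  difference \<open>x - y\<close> is treated directly; adding y to both sides is a common
  map.\<close>

lemma gauss_dominated_rounded_normal:
  assumes "0 < s"
  shows "gauss_dominated ((real_of_int (x - y) / (2 ^ q * s))\<^sup>2)
    (map_pmf ((+) x) (rounded_normal s q)) (map_pmf ((+) y) (rounded_normal s q))"
proof -
  let ?N = "rounded_normal s q"
  let ?A = "\<lambda>z. {x :: real. round (x * 2 ^ q) = z}"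
  define m where "m = x - y"
  define a where "a = real_of_int m / 2 ^ q"
  have [measurable]: "(\<lambda>x::real. round (x * 2 ^ q) :: int) \<in> borel \<rightarrow>\<^sub>M count_space UNIV"
    unfolding round_def by measurable
  have pmf: "pmf (map_pmf ((+) m) ?N) z = pmf ?N (z - m)" for z
    using pmf_map_inj' [of "(+) m" ?N "z - m"] by simp
  have "gauss_dominated ((a / s)\<^sup>2) (map_pmf ((+) m) ?N) ?N"
    unfolding gauss_dominated_def
  proof (intro allI impI)
    fix c :: real assume c: "0 \<le> c"
    let ?f = "\<lambda>x. ennreal (normal_density a s x - c * normal_density 0 s x)"
    have "(\<integral>\<^sup>+z. ennreal (pmf (map_pmf ((+) m) ?N) z - c * pmf ?N z) \<partial>count_space UNIV)
        \<le> (\<integral>\<^sup>+z. \<integral>\<^sup>+x. ?f x * indicator {round (x * 2 ^ q)} z \<partial>lborel \<partial>count_space UNIV)"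
    proof (rule nn_integral_mono)
      fix z
      have "ennreal (pmf (map_pmf ((+) m) ?N) z - c * pmf ?N z)
          \<le> (\<integral>\<^sup>+x. ennreal (normal_density a s x * indicator (?A z) x
              - c * (normal_density 0 s x * indicator (?A z) x)) \<partial>lborel)"
        using c ennreal_pmf_rounded_normal [OF assms, of q z m] ennreal_pmf_rounded_normal [OF assms, of q z 0]
        by (intro ennreal_diff_le_nn_integral) (auto simp: pmf a_def)
      also have "\<dots> = (\<integral>\<^sup>+x. ?f x * indicator {round (x * 2 ^ q)} z \<partial>lborel)"
        by (intro nn_integral_cong) (auto simp: indicator_def)
      finally show "ennreal (pmf (map_pmf ((+) m) ?N) z - c * pmf ?N z)
          \<le> (\<integral>\<^sup>+x. ?f x * indicator {round (x * 2 ^ q)} z \<partial>lborel)" .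
    qed
    also have "\<dots> = (\<integral>\<^sup>+x. \<integral>\<^sup>+z. ?f x * indicator {round (x * 2 ^ q)} z \<partial>count_space UNIV \<partial>lborel)"
      by (rule nn_integral_count_space_nn_integral [symmetric]) auto
    also have "\<dots> = (\<integral>\<^sup>+x. ?f x \<partial>lborel)"
      by simp
    also have "\<dots> = gauss_profile ((a / s)\<^sup>2) c"
      using assms by (rule nn_integral_normal_hockey_stick)
    finally show "(\<integral>\<^sup>+z. ennreal (pmf (map_pmf ((+) m) ?N) z - c * pmf ?N z) \<partial>count_space UNIV)
        \<le> gauss_profile ((a / s)\<^sup>2) c" .
  qed
  then have "gauss_dominated ((a / s)\<^sup>2) (map_pmf ((+) y) (map_pmf ((+) m) ?N)) (map_pmf ((+) y) ?N)"
    by (rule gauss_dominated_map) simp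
  then show ?thesis
    by (simp add: pmf.map_comp comp_def a_def m_def add.assoc [symmetric])
qed

lemma gauss_dominated_replicate_rounded_normal:
  assumes "0 < s" "length xs = length ys"
  shows "gauss_dominated (\<Sum>(x, y)\<leftarrow>zip xs ys. (real_of_int (x - y) / (2 ^ q * s))\<^sup>2)
    (map_pmf (map2 (+) xs) (replicate_pmf (length xs) (rounded_normal s q)))
    (map_pmf (map2 (+) ys) (replicate_pmf (length xs) (rounded_normal s q)))"
  using assms(2)
proof (induction xs ys rule: list_induct2)
  case Nil
  show ?case by (simp add: gauss_dominated_refl)
next
  case (Cons x xs y ys)
  let ?N = "rounded_normal s q"
  have step: "map_pmf (map2 (+) (u # us)) (replicate_pmf (length (x # xs)) ?N)
      = map_pmf ((+) u) ?N \<bind> (\<lambda>z. map_pmf ((#) z) (map_pmf (map2 (+) us) (replicate_pmf (length xs) ?N)))"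
    for u us
    by (simp add: map_bind_pmf bind_map_pmf pmf.map_comp comp_def) (simp add: map_pmf_def)
  have nonneg: "0 \<le> (\<Sum>(x, y)\<leftarrow>zip xs ys. (real_of_int (x - y) / (2 ^ q * s))\<^sup>2)"
    by (intro sum_list_nonneg) auto
  show ?case
    unfolding step zip_Cons_Cons list.map sum_list.Cons prod.case
    using assms(1) Cons.IH nonneg
    by (intro gauss_dominated_bind gauss_dominated_rounded_normal gauss_dominated_map) auto
qed

section \<open>Prefixes of pseudorandom streams\<close>

text \<open>
  State 2 skips the security parameter and its separator, state \<open>i + 3\<close> expects the bit \<open>u ! i\<close>.
\<close>

definition match_ptm :: "bool list \<Rightarrow> ptm" where
  "match_ptm u = \<lparr>num_states = length u + 4, num_symbols = 4,
     transition = (\<lambda>c p a.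
       if p = 2 then (if a = 2 then (2, a, 1) else if a = 3 then (3, a, 1) else (0, a, 0))
       else if p < length u + 3 then
         (if a = (if u ! (p - 3) then 2 else 1) then (Suc p, a, 1) else (0, a, 0))
       else (1, a, 0))\<rparr>"

lemma wf_match_ptm: "wf_ptm (match_ptm u)"
  by (auto simp: wf_ptm_def match_ptm_def)

lemma fold_ptm_step_halted: "fst cfg \<in> {0, 1} \<Longrightarrow> fold (ptm_step A) coins cfg = cfg"
  by (induction coins) (cases cfg; auto)+

lemma match_ptm_skip:
  "(\<And>j. j < length coins \<Longrightarrow> tape (h + int j) = 2) \<Longrightarrow>
    fold (ptm_step (match_ptm u)) coins (2, tape, h) = (2, tape, h + int (length coins))"
proof (induction coins arbitrary: h)
  case (Cons c coins)
  have "tape (h + 1 + int j) = 2" if "j < length coins" for j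
    using Cons.prems [of "Suc j"] that by (simp add: add.assoc)
  moreover have "ptm_step (match_ptm u) c (2, tape, h) = (2, tape, h + 1)"
    using Cons.prems [of 0] by (simp add: match_ptm_def fun_upd_idem)
  ultimately show ?case
    using Cons.IH [of "h + 1"] by simp
qed simp

text \<open>The last coin \<open>c\<close> pays for the move from state \<open>length u + 3\<close>
  to the accepting state 1. A mismatch leads to state 0, where the remaining coins have no
  effect.\<close>

lemma match_ptm_compare:
  assumes "i + length coins = length u"
  shows "fst (fold (ptm_step (match_ptm u)) (coins @ [c]) (i + 3, tape, h))
    = of_bool (\<forall>j<length coins. tape (h + int j) = (if u ! (i + j) then 2 else 1))"
  using assms
proof (induction coins arbitrary: i h)
  case Nil
  then show ?case by (simp add: match_ptm_def)
next
  case (Cons b coins)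
  let ?match = "\<lambda>i h j. tape (h + int j) = (if u ! (i + j) then 2 else 1)"
  have split: "(\<forall>j<length (b # coins). ?match i h j) \<longleftrightarrow> ?match i h 0 \<and> (\<forall>j<length coins. ?match (Suc i) (h + 1) j)"
    by (simp add: All_less_Suc2 add.assoc)
  show ?case
  proof (cases "?match i h 0")
    case True
    then have "ptm_step (match_ptm u) b (i + 3, tape, h) = (Suc i + 3, tape, h + 1)"
      using Cons.prems by (auto simp: match_ptm_def fun_upd_idem)
    then show ?thesis
      using Cons.IH [of "Suc i" "h + 1"] Cons.prems True unfolding split by simp
  next
    case False
    then have "ptm_step (match_ptm u) b (i + 3, tape, h) = (0, tape, h)"
      using Cons.prems by (auto simp: match_ptm_def fun_upd_idem)
    then show ?thesis
      using False fold_ptm_step_halted [of "(0, tape, h)"] unfolding split by simp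
  qed
qed

lemma final_state_match_ptm:
  assumes "length coins = n + length u + 2"
  shows "final_state (match_ptm u) n x coins = of_bool (take (length u) x = u)"
proof -
  \<comment> \<open>\<open>cs\<close> is spent on the unary parameter, \<open>c\<close> on the
    separator, \<open>ds\<close> on the bits of \<open>u\<close>, and \<open>d\<close> on entering
    the halting state; hence \<open>n + length u + 2\<close> coins.\<close>
  obtain cs ds :: "bool list" and c d where coins: "coins = cs @ c # ds @ [d]" and len: "length cs = n" "length ds = length u"
  proof -
    have "coins \<noteq> []" using assms by auto
    then have "coins = butlast coins @ [last coins]" by simp
    moreover have "butlast coins = take n coins @ coins ! n # drop (Suc n) (butlast coins)"
      using assms by (subst id_take_nth_drop [of n]) (auto simp: nth_butlast take_butlast)
    ultimately have "coins = take n coins @ coins ! n # drop (Suc n) (butlast coins) @ [last coins]"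
      by (metis append_Cons append_assoc)
    then show thesis
      by (rule that) (use assms in auto)
  qed
  define w where "w = replicate n 2 @ [3] @ map (\<lambda>b. if b then 2 else 1 :: nat) x"
  define tape where "tape i = (if 0 \<le> i \<and> i < int (length w) then w ! nat i else 0)" for i
  have skip: "fold (ptm_step (match_ptm u)) cs (2, tape, 0) = (2, tape, int n)"
    using match_ptm_skip [of cs tape 0 u] len by (simp add: tape_def w_def nth_append)
  have sep: "ptm_step (match_ptm u) c (2, tape, int n) = (3, tape, int n + 1)"
    by (simp add: match_ptm_def tape_def w_def nth_append fun_upd_idem)
  \<comment> \<open>Beyond the input the tape holds the blank 0, which differs from both bit
    symbols, so an input shorter than \<open>u\<close> is rejected.\<close>
  have sym: "tape (int n + 1 + int j) = (if j < length x then if x ! j then 2 else 1 else 0)" for j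
    by (auto simp: tape_def w_def nth_append nat_add_distrib)
  have "take (length u) x = u \<longleftrightarrow> (\<forall>j<length u. j < length x \<and> x ! j = u ! j)"
  proof
    assume "take (length u) x = u"
    then show "\<forall>j<length u. j < length x \<and> x ! j = u ! j"
      by (metis length_take min_less_iff_conj nth_take)
  next
    assume *: "\<forall>j<length u. j < length x \<and> x ! j = u ! j"
    then have "length u \<le> length x"
      by (meson le_less_linear less_irrefl)
    with * show "take (length u) x = u" by (intro nth_equalityI) auto
  qed
  also have "\<dots> \<longleftrightarrow> (\<forall>j<length ds. tape (int n + 1 + int j) = (if u ! (0 + j) then 2 else 1))"
    unfolding sym len by auto
  finally have eq: "take (length u) x = u \<longleftrightarrow> \<dots>" .
  have "final_state (match_ptm u) n x coins = fst (fold (ptm_step (match_ptm u)) (ds @ [d]) (0 + 3, tape, int n + 1))"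
    unfolding final_state_def initial_config_def Let_def w_def [symmetric] tape_def [abs_def, symmetric] coins
    using skip sep by simp
  also have "\<dots> = of_bool (take (length u) x = u)"
    unfolding eq using len by (intro match_ptm_compare) simp
  finally show ?thesis .
qed

lemma ppt_match_ptm: "ppt (match_ptm u) [:length u + 2, 1:]"
  by (auto simp: ppt_def wf_match_ptm final_state_match_ptm of_bool_def)

lemma finite_bool_lists: "finite {s :: bool list. length s = n}"
  using finite_lists_length_eq [of "UNIV :: bool set" n] by simp

lemma bool_lists_nonempty: "{s :: bool list. length s = n} \<noteq> {}"
  by (metis (mono_tags) Collect_empty_eq length_replicate)

lemma set_uniform_bits [simp]: "set_pmf (uniform_bits n) = {s. length s = n}"
  unfolding uniform_bits_def by (rule set_pmf_of_set) (rule bool_lists_nonempty finite_bool_lists)+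

lemma decision_match_ptm:
  "decision (match_ptm u) [:length u + 2, 1:] n x = return_pmf (take (length u) x = u)"
proof -
  have "decision (match_ptm u) [:length u + 2, 1:] n x
      = map_pmf (\<lambda>_. take (length u) x = u) (uniform_bits (poly [:length u + 2, 1:] n))"
    unfolding decision_def by (intro map_pmf_cong) (auto simp: final_state_match_ptm)
  then show ?thesis by simp
qed

lemma negligible_sum:
  assumes "\<And>i. i \<in> I \<Longrightarrow> negligible (f i)"
  shows "negligible (\<lambda>n. \<Sum>i\<in>I. f i n)"
  using assms unfolding negligible_def by (auto intro: big_sum_in_smallo)

lemma negligible_cmult: "negligible \<nu> \<Longrightarrow> negligible (\<lambda>n. c * \<nu> n)"
  unfolding negligible_def by (cases "c = 0") auto

text \<open>The L1 distance (twice the total variation distance) of a generated prefix from uniform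
  bits. The length \<open>l\<close> stays fixed while \<open>n\<close> grows, so the number of
  summands is constant.\<close>

definition prefix_distance :: "(bool list \<Rightarrow> nat \<Rightarrow> bool) \<Rightarrow> nat \<Rightarrow> nat \<Rightarrow> real" where
  "prefix_distance G l n = (\<Sum>u | length u = l.
     \<bar>pmf (map_pmf (\<lambda>s. map (G s) [0..<l]) (uniform_bits n)) u - pmf (uniform_bits l) u\<bar>)"

text \<open>Each summand is the distinguishing advantage of the machine that tests for the string
  \<open>u\<close>, and finitely many negligible functions add up to a negligible one.\<close>

lemma negligible_prefix_distance:
  assumes "secure_prng G"
  shows "negligible (prefix_distance G l)"
  unfolding prefix_distance_def
proof (rule negligible_sum)
  fix u :: "bool list"
  assume "u \<in> {u. length u = l}"
  then have l: "length u = l" by simp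
  have single: "pmf (map_pmf (\<lambda>x. x = u) P) True = pmf P u" for P :: "bool list pmf"
    by (simp add: pmf_map vimage_def measure_pmf_single)
  have U: "pmf (do { x \<leftarrow> uniform_bits l; decision (match_ptm u) [:length u + 2, 1:] n x }) True
      = pmf (uniform_bits l) u" for n
  proof -
    have "do { x \<leftarrow> uniform_bits l; decision (match_ptm u) [:length u + 2, 1:] n x }
        = map_pmf (\<lambda>x. x = u) (uniform_bits l)"
      unfolding decision_match_ptm map_pmf_def by (intro bind_pmf_cong) (auto simp: l)
    then show ?thesis by (simp add: single)
  qed
  have G: "pmf (do { s \<leftarrow> uniform_bits n; decision (match_ptm u) [:length u + 2, 1:] n (map (G s) [0..<l]) }) True
      = pmf (map_pmf (\<lambda>s. map (G s) [0..<l]) (uniform_bits n)) u" for n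
  proof -
    have "do { s \<leftarrow> uniform_bits n; decision (match_ptm u) [:length u + 2, 1:] n (map (G s) [0..<l]) }
        = map_pmf (\<lambda>x. x = u) (map_pmf (\<lambda>s. map (G s) [0..<l]) (uniform_bits n))"
      unfolding decision_match_ptm by (simp add: l pmf.map_comp comp_def) (simp add: map_pmf_def)
    then show ?thesis by (simp add: single)
  qed
  show "negligible (\<lambda>n. \<bar>pmf (map_pmf (\<lambda>s. map (G s) [0..<l]) (uniform_bits n)) u - pmf (uniform_bits l) u\<bar>)"
    \<comment> \<open>\<open>[:l:]\<close> is a constant polynomial: the prefix length is
      independent of the security parameter.\<close>
    using assms [unfolded secure_prng_def, rule_format, OF ppt_match_ptm, of u "[:l:]"]
    by (simp only: U G poly_pCons poly_0 mult_zero_right add_0_right)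
qed

text \<open>Statistical closeness survives an arbitrary continuation \<open>f\<close>. This matters
  because \<open>f\<close> will contain the run of the protocol itself, with its real data and
  centroids, which no polynomial-time machine could be handed.\<close>

lemma pmf_bind_prefix_distance:
  "\<bar>pmf (do { s \<leftarrow> uniform_bits n; f (map (G s) [0..<l]) }) y - pmf (uniform_bits l \<bind> f) y\<bar>
    \<le> prefix_distance G l n"
proof -
  let ?P = "map_pmf (\<lambda>s. map (G s) [0..<l]) (uniform_bits n)"
  let ?S = "{u :: bool list. length u = l}"
  have sum: "pmf (p \<bind> f) y = (\<Sum>u\<in>?S. pmf (f u) y * pmf p u)" if "set_pmf p \<subseteq> ?S" for p
    unfolding pmf_bind using that
    by (subst integral_measure_pmf_real [OF finite_bool_lists [of l]]) auto
  have "\<bar>pmf (do { s \<leftarrow> uniform_bits n; f (map (G s) [0..<l]) }) y - pmf (uniform_bits l \<bind> f) y\<bar>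
      = \<bar>pmf (?P \<bind> f) y - pmf (uniform_bits l \<bind> f) y\<bar>"
    by (simp add: bind_map_pmf)
  also have "\<dots> = \<bar>\<Sum>u\<in>?S. pmf (f u) y * (pmf ?P u - pmf (uniform_bits l) u)\<bar>"
    by (subst (1 2) sum) (auto simp: sum_subtractf right_diff_distrib)
  also have "\<dots> \<le> (\<Sum>u\<in>?S. \<bar>pmf (f u) y * (pmf ?P u - pmf (uniform_bits l) u)\<bar>)"
    by (rule sum_abs)
  also have "\<dots> \<le> prefix_distance G l n"
    unfolding prefix_distance_def
    by (intro sum_mono) (auto simp: abs_mult pmf_le_1 intro: mult_left_le_one_le)
  finally show ?thesis .
qed

section \<open>The view of the server\<close>

definition masked :: "nat \<Rightarrow> real list list \<Rightarrow> 'w::len word list list \<Rightarrow> 'w word list list" where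
  "masked q vs rs = map2 (map2 (+)) (map (encode_fixed q) vs) rs"

text \<open>The server's half of \<open>global_msa\<close>: it sees the data only through the masked
  uploads.\<close>

definition respond :: "nat \<Rightarrow> nat \<Rightarrow> real \<Rightarrow> 'w::len word list list \<Rightarrow> ('w word list list \<times> 'w word list) pmf" where
  "respond q l s us = map_pmf (\<lambda>noise. (us, map2 (+) (sum_lists l us) (map word_of_int noise)))
     (replicate_pmf l (rounded_normal s q))"

lemma global_msa_eq_respond: "global_msa q l s vs rs = respond q l s (masked q vs rs)"
  by (simp add: global_msa_def respond_def masked_def map_pmf_def Let_def)

definition offsets :: "'d::finite fastlloyd \<Rightarrow> (nat \<Rightarrow> real ^ 'd) \<Rightarrow> (nat \<Rightarrow> (real ^ 'd) multiset) \<Rightarrow> real list list" where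
  "offsets prot \<mu> D = map (\<lambda>i. flatten (clusters prot) (local_sum prot \<mu> (D i))) [0..<clients prot]"

definition counts :: "'d::finite fastlloyd \<Rightarrow> (nat \<Rightarrow> real ^ 'd) \<Rightarrow> (nat \<Rightarrow> (real ^ 'd) multiset) \<Rightarrow> real list list" where
  "counts prot \<mu> D = map (\<lambda>i. map (local_count prot \<mu> (D i)) [0..<clusters prot]) [0..<clients prot]"

definition noise_R :: "'d::finite fastlloyd \<Rightarrow> real \<Rightarrow> real" where
  "noise_R prot \<sigma> = sigma_R CARD('d) \<sigma> * radius prot * sqrt (real (iterations prot))"

definition noise_C :: "'d::finite fastlloyd \<Rightarrow> real \<Rightarrow> real" where
  "noise_C prot \<sigma> = sigma_C CARD('d) \<sigma> * sqrt (real (iterations prot))"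

definition next_centroids ::
  "'d::finite fastlloyd \<Rightarrow> (nat \<Rightarrow> bool) \<Rightarrow> nat \<Rightarrow> 'w::len word list \<Rightarrow> 'w word list \<Rightarrow> (nat \<Rightarrow> real ^ 'd) \<Rightarrow> nat \<Rightarrow> real ^ 'd"
where
  "next_centroids prot g t bR bC \<mu> =
     (let q = precision prot; k = clusters prot;
          R = unflatten (unmask q (k * CARD('d)) (masks_R prot g t) bR);
          C = (!) (unmask q k (masks_C prot g t) bC)
      in (\<lambda>j. post_process prot (R j) (C j) (\<mu> j)))"

definition respond_both ::
  "'d::finite fastlloyd \<Rightarrow> real \<Rightarrow> 'w::len word list list \<times> 'w word list list \<Rightarrow>
    (('w word list list \<times> 'w word list) \<times> ('w word list list \<times> 'w word list)) pmf" where
  "respond_both prot \<sigma> = (\<lambda>(uR, uC). pair_pmf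
     (respond (precision prot) (clusters prot * CARD('d)) (noise_R prot \<sigma>) uR)
     (respond (precision prot) (clusters prot) (noise_C prot \<sigma>) uC))"

definition uploads ::
  "'d::finite fastlloyd \<Rightarrow> (nat \<Rightarrow> bool) \<Rightarrow> (nat \<Rightarrow> (real ^ 'd) multiset) \<Rightarrow> nat \<Rightarrow> (nat \<Rightarrow> real ^ 'd) \<Rightarrow>
    'w::len word list list \<times> 'w word list list" where
  "uploads prot g D t \<mu> =
     (masked (precision prot) (offsets prot \<mu> D) (masks_R prot g t),
      masked (precision prot) (counts prot \<mu> D) (masks_C prot g t))"

text \<open>All sampling of an iteration is gathered in \<open>respond_both\<close>, and what
  follows is deterministic. Both views are analysed in this form, so the original equation leaves
  the simp set.\<close>

lemma run_Suc:
  "run prot \<sigma> g D (Suc t) = run prot \<sigma> g D t \<bind> (\<lambda>(\<mu>, tr).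
     map_pmf (\<lambda>(mR, mC). (next_centroids prot g t (snd mR) (snd mC) \<mu>, tr @ [mR, mC]))
       (respond_both prot \<sigma> (uploads prot g D t \<mu>)))"
  by (simp add: uploads_def respond_both_def global_msa_eq_respond offsets_def counts_def noise_R_def noise_C_def
      next_centroids_def pair_pmf_def map_pmf_def bind_assoc_pmf bind_return_pmf Let_def case_prod_unfold)

declare run.simps(2) [simp del]

definition block_bits :: "'d::finite fastlloyd \<Rightarrow> 'w::len itself \<Rightarrow> nat" where
  "block_bits prot _ = clients prot * (clusters prot * CARD('d) + clusters prot) * LENGTH('w)"

definition consumed_bits :: "'d::finite fastlloyd \<Rightarrow> 'w::len itself \<Rightarrow> nat \<Rightarrow> nat" where
  "consumed_bits prot W t = init_bits prot + t * block_bits prot W"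

lemma consumed_bits_Suc:
  "consumed_bits prot W (Suc t) = consumed_bits prot W t + block_bits prot W"
  by (simp add: consumed_bits_def)

lemma mask_entry_eq:
  fixes prot :: "'d::finite fastlloyd"
  shows "(mask_entry prot g t i e :: 'w::len word) = horner_sum of_bool 2
    (map (\<lambda>b. g (consumed_bits prot TYPE('w) t
       + ((i * (clusters prot * CARD('d) + clusters prot) + e) * LENGTH('w) + b))) [0..<LENGTH('w)])"
  by (simp add: mask_entry_def mask_word_def consumed_bits_def block_bits_def algebra_simps)

lemma mask_position_less:
  fixes prot :: "'d::finite fastlloyd"
  assumes "i < clients prot" "e < clusters prot * CARD('d) + clusters prot" "b < LENGTH('w::len)"
  shows "(i * (clusters prot * CARD('d) + clusters prot) + e) * LENGTH('w) + b < block_bits prot TYPE('w)"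
proof -
  have less: "x * n + y < m * n" if "x < m" "y < n" for x y m n :: nat
  proof -
    have "x * n + y < Suc x * n" using that by simp
    also have "\<dots> \<le> m * n" using that by (intro mult_le_mono1) simp
    finally show ?thesis .
  qed
  show ?thesis
    unfolding block_bits_def using assms by (intro less)
qed

lemma masks_cong:
  fixes prot :: "'d::finite fastlloyd"
  assumes "\<And>i. i < consumed_bits prot TYPE('w::len) (Suc t) \<Longrightarrow> g i = g' i"
  shows "masks_R prot g t = (masks_R prot g' t :: 'w word list list)"
    and "masks_C prot g t = (masks_C prot g' t :: 'w word list list)"
proof -
  have "mask_entry prot g t i e = (mask_entry prot g' t i e :: 'w word)"
    if "i < clients prot" "e < clusters prot * CARD('d) + clusters prot" for i e
    unfolding mask_entry_eq using mask_position_less [OF that, where 'w = 'w]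
    by (intro arg_cong [where f = "horner_sum of_bool 2"] map_cong refl assms)
      (simp add: consumed_bits_def)
  then show "masks_R prot g t = (masks_R prot g' t :: 'w word list list)"
    and "masks_C prot g t = (masks_C prot g' t :: 'w word list list)"
    by (auto simp: masks_R_def masks_C_def)
qed

text \<open>Cuts the infinite stream to a finite prefix, and shows that bits drawn for later masks
  cannot influence earlier iterations.\<close>

lemma run_cong:
  fixes prot :: "'d::finite fastlloyd"
  assumes "\<And>i. i < consumed_bits prot TYPE('w::len) t \<Longrightarrow> g i = g' i"
  shows "run prot \<sigma> g D t = (run prot \<sigma> g' D t :: ((nat \<Rightarrow> real ^ 'd) \<times> ('w word list list \<times> 'w word list) list) pmf)"
  using assms
proof (induction t)
  case 0
  then have "map g [0..<init_bits prot] = map g' [0..<init_bits prot]"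
    by (auto simp: consumed_bits_def)
  then show ?case by (simp only: run.simps(1))
next
  case (Suc t)
  have "run prot \<sigma> g D t = (run prot \<sigma> g' D t :: (_ \<times> ('w word list list \<times> _) list) pmf)"
    using Suc.prems by (intro Suc.IH) (auto simp: consumed_bits_def)
  moreover have "masks_R prot g t = (masks_R prot g' t :: 'w word list list)"
    "masks_C prot g t = (masks_C prot g' t :: 'w word list list)"
    using masks_cong Suc.prems by blast+
  ultimately show ?case
    unfolding run_Suc by (simp add: uploads_def next_centroids_def)
qed

text \<open>Every bit of the block shows up in some mask: the mixed-radix digits of \<open>p\<close>
  name the client, the matrix entry and the bit inside the word. Entries from
  \<open>clusters prot * CARD('d)\<close> on belong to the counts.\<close>

lemma masks_inj:
  fixes prot :: "'d::finite fastlloyd"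
  assumes "masks_R prot g t = (masks_R prot g' t :: 'w::len word list list)"
    and "masks_C prot g t = (masks_C prot g' t :: 'w word list list)"
    and "p < block_bits prot TYPE('w)"
  shows "g (consumed_bits prot TYPE('w) t + p) = g' (consumed_bits prot TYPE('w) t + p)"
proof -
  let ?d = "clusters prot * CARD('d)" and ?n = "clusters prot * CARD('d) + clusters prot" and ?w = "LENGTH('w)"
  define b where "b = p mod ?w"
  define e where "e = p div ?w mod ?n"
  define i where "i = p div ?w div ?n"
  have "0 < ?n" using assms(3) by (cases "clusters prot = 0") (auto simp: block_bits_def)
  have p: "p = (i * ?n + e) * ?w + b" by (simp only: i_def e_def b_def div_mult_mod_eq)
  have b: "b < ?w" by (simp add: b_def)
  have e: "e < ?n" using \<open>0 < ?n\<close> by (simp add: e_def)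
  have i: "i < clients prot"
    unfolding i_def using assms(3) by (intro less_mult_imp_div_less) (simp add: block_bits_def)
  have entry: "mask_entry prot g t i e = (mask_entry prot g' t i e :: 'w word)"
  proof (cases "e < ?d")
    case True
    have "(masks_R prot g t :: 'w word list list) ! i ! e = masks_R prot g' t ! i ! e"
      by (simp add: assms(1))
    then show ?thesis using True i by (simp add: masks_R_def del: upt_Suc)
  next
    case False
    have "(masks_C prot g t :: 'w word list list) ! i ! (e - ?d) = masks_C prot g' t ! i ! (e - ?d)"
      by (simp add: assms(2))
    moreover have "[0..<clusters prot] ! (e - ?d) = e - ?d" using False e by simp
    ultimately show ?thesis using False e i by (simp add: masks_C_def)
  qed
  have "bit (mask_entry prot g t i e :: 'w word) b = g (consumed_bits prot TYPE('w) t + p)" for g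
    unfolding mask_entry_eq bit_horner_sum_bit_iff p using b by simp
  from this [of g] this [of g'] entry show ?thesis by simp
qed

section \<open>Uniformity of the masked uploads\<close>

text \<open>Both levels have the shape expected by \<open>finite_lists_length_eq\<close> and
  \<open>card_lists_length_eq\<close>, which are applied to rows and then to lists of rows.\<close>

definition matrices :: "nat \<Rightarrow> nat \<Rightarrow> 'a list list set" where
  "matrices m l = {A. set A \<subseteq> {r. set r \<subseteq> UNIV \<and> length r = l} \<and> length A = m}"

lemma finite_matrices: "finite (matrices m l :: 'a::finite list list set)"
  and card_matrices: "card (matrices m l :: 'a::finite list list set) = (CARD('a) ^ l) ^ m"
  unfolding matrices_def
  by (simp_all only: finite_lists_length_eq card_lists_length_eq finite_class.finite)

lemma map2_add_left_cancel:
  fixes xs ys zs :: "'a::cancel_semigroup_add list"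
  assumes "map2 (+) xs ys = map2 (+) xs zs" "length ys = length xs" "length zs = length xs"
  shows "ys = zs"
proof (rule nth_equalityI)
  fix i assume "i < length ys"
  moreover have "map2 (+) xs ys ! i = map2 (+) xs zs ! i" by (simp only: assms(1))
  ultimately show "ys ! i = zs ! i" using assms(2,3) by simp
qed (use assms in simp)

lemma map2_map2_add_left_cancel:
  fixes V A B :: "'a::cancel_semigroup_add list list"
  assumes "map2 (map2 (+)) V A = map2 (map2 (+)) V B" "V \<in> matrices m l" "A \<in> matrices m l" "B \<in> matrices m l"
  shows "A = B"
proof (rule nth_equalityI)
  fix i assume i: "i < length A"
  have "map2 (map2 (+)) V A ! i = map2 (map2 (+)) V B ! i" by (simp only: assms(1))
  then have "map2 (+) (V ! i) (A ! i) = map2 (+) (V ! i) (B ! i)"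
    using i assms(2-4) by (simp add: matrices_def)
  moreover have "length (V ! i) = l" "length (A ! i) = l" "length (B ! i) = l"
    using i assms(2-4) by (auto simp: matrices_def subset_iff)
  ultimately show "A ! i = B ! i"
    using map2_add_left_cancel [of "V ! i" "A ! i" "B ! i"] by simp
qed (use assms in \<open>simp add: matrices_def\<close>)

lemma map2_map2_in_matrices:
  "V \<in> matrices m l \<Longrightarrow> A \<in> matrices m l \<Longrightarrow> map2 (map2 f) V A \<in> matrices m l"
  by (auto simp: matrices_def set_zip subset_iff)

lemma length_flatten [simp]: "length (flatten k (R :: nat \<Rightarrow> real ^ 'd::finite)) = k * CARD('d)"
  by (induction k) (simp_all add: flatten_def)

lemma masks_in_matrices:
  fixes prot :: "'d::finite fastlloyd"
  shows "masks_R prot g t \<in> matrices (clients prot) (clusters prot * CARD('d))"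
    and "masks_C prot g t \<in> matrices (clients prot) (clusters prot)"
  by (auto simp: matrices_def masks_R_def masks_C_def)

lemma data_in_matrices:
  fixes prot :: "'d::finite fastlloyd"
  shows "offsets prot \<mu> D \<in> matrices (clients prot) (clusters prot * CARD('d))"
    and "counts prot \<mu> D \<in> matrices (clients prot) (clusters prot)"
  by (auto simp: matrices_def offsets_def counts_def)

lemma encode_in_matrices: "vs \<in> matrices m l \<Longrightarrow> map (encode_fixed q) vs \<in> matrices m l"
  by (auto simp: matrices_def encode_fixed_def)

definition upload_space :: "'d::finite fastlloyd \<Rightarrow> ('w::len word list list \<times> 'w word list list) set" where
  "upload_space prot = matrices (clients prot) (clusters prot * CARD('d)) \<times> matrices (clients prot) (clusters prot)"

text \<open>A one-time pad, by counting: for fixed centroids and data, the map from fresh bits to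
  uploads is injective (cancel the data, then \<open>masks_inj\<close>), and its codomain has as
  many elements as there are bit strings. So it is a bijection and preserves uniformity.\<close>

lemma uploads_uniform:
  fixes prot :: "'d::finite fastlloyd"
  assumes u: "length u = consumed_bits prot TYPE('w::len) t"
  shows "map_pmf (\<lambda>v. uploads prot ((!) (u @ v)) D t \<mu>) (uniform_bits (block_bits prot TYPE('w)))
    = pmf_of_set (upload_space prot :: ('w word list list \<times> 'w word list list) set)"
proof -
  let ?V = "{v :: bool list. length v = block_bits prot TYPE('w)}"
  let ?S = "upload_space prot :: ('w word list list \<times> 'w word list list) set"
  let ?F = "\<lambda>v. uploads prot ((!) (u @ v)) D t \<mu> :: 'w word list list \<times> 'w word list list"
  have inj: "inj_on ?F ?V"
  proof (rule inj_onI)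
    fix v v' assume len: "v \<in> ?V" "v' \<in> ?V" and eq: "?F v = ?F v'"
    from eq have "masks_R prot ((!) (u @ v)) t = (masks_R prot ((!) (u @ v')) t :: 'w word list list)"
      unfolding uploads_def masked_def prod.inject
      by (rule map2_map2_add_left_cancel [OF conjunct1]) (assumption | rule encode_in_matrices masks_in_matrices data_in_matrices)+
    moreover from eq have "masks_C prot ((!) (u @ v)) t = (masks_C prot ((!) (u @ v')) t :: 'w word list list)"
      unfolding uploads_def masked_def prod.inject
      by (rule map2_map2_add_left_cancel [OF conjunct2]) (assumption | rule encode_in_matrices masks_in_matrices data_in_matrices)+
    ultimately have "g = h" if "g = (u @ v) ! (length u + p)" "h = (u @ v') ! (length u + p)"
      "p < block_bits prot TYPE('w)" for g h p
      using masks_inj [of prot "(!) (u @ v)" t "(!) (u @ v')" p] that u by simp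
    then show "v = v'"
      using len by (intro nth_equalityI) auto
  qed
  have sub: "?F ` ?V \<subseteq> ?S"
    by (auto simp: uploads_def masked_def upload_space_def intro!: map2_map2_in_matrices encode_in_matrices masks_in_matrices data_in_matrices)
  have card: "card ?S = card ?V"
  proof -
    have "card ?V = 2 ^ block_bits prot TYPE('w)"
      using card_lists_length_eq [of "UNIV :: bool set"] by simp
    then show ?thesis
      by (simp add: upload_space_def card_cartesian_product card_matrices card_word block_bits_def
          power_mult [symmetric] power_add [symmetric] algebra_simps)
  qed
  have "?F ` ?V = ?S"
    using sub card inj
    by (intro card_subset_eq) (auto simp: upload_space_def card_image finite_matrices)
  with inj have "bij_betw ?F ?V ?S" by (simp add: bij_betw_def)
  then show ?thesis
    unfolding uniform_bits_def by (rule map_pmf_of_set_bij_betw) (rule bool_lists_nonempty finite_bool_lists)+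
qed

lemma uniform_bits_add:
  "uniform_bits (m + n) = do { u \<leftarrow> uniform_bits m; v \<leftarrow> uniform_bits n; return_pmf (u @ v) }"
proof -
  let ?S = "\<lambda>n. {s :: bool list. length s = n}"
  have "pair_pmf (uniform_bits m) (uniform_bits n) = pmf_of_set (?S m \<times> ?S n)"
  proof (rule pmf_eqI)
    fix x :: "bool list \<times> bool list"
    show "pmf (pair_pmf (uniform_bits m) (uniform_bits n)) x = pmf (pmf_of_set (?S m \<times> ?S n)) x"
      unfolding uniform_bits_def
      by (cases x, subst pmf_of_set) (simp_all only: pmf_pair pmf_of_set [OF bool_lists_nonempty finite_bool_lists]
          Times_empty bool_lists_nonempty finite_bool_lists finite_cartesian_product card_cartesian_product
          indicator_times fst_conv snd_conv of_nat_mult times_divide_times_eq simp_thms)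
  qed
  moreover have "bij_betw (\<lambda>(u, v). u @ v) (?S m \<times> ?S n) (?S (m + n))"
    by (rule bij_betw_byWitness [where f' = "\<lambda>w. (take m w, drop m w)"]) auto
  ultimately have "uniform_bits (m + n) = map_pmf (\<lambda>(u, v). u @ v) (pair_pmf (uniform_bits m) (uniform_bits n))"
    using map_pmf_of_set_bij_betw [of "\<lambda>(u, v). u @ v" "?S m \<times> ?S n" "?S (m + n)"]
    by (simp only: uniform_bits_def Times_empty finite_bool_lists bool_lists_nonempty finite_cartesian_product simp_thms)
  then show ?thesis
    by (simp add: pair_pmf_def map_pmf_def bind_assoc_pmf bind_return_pmf)
qed

definition server_messages :: "('w word list list \<times> 'w word list) list \<Rightarrow> 'w::len word list list" where
  "server_messages tr = concat (map (\<lambda>(u, b). u @ [b]) tr)"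

text \<open>The data enter the right side only through the messages of the first \<open>t\<close>
  iterations. Thus the hidden centroids disappear from the recursion, and independence of the data
  follows by induction.\<close>

lemma server_messages_run_Suc:
  fixes prot :: "'d::finite fastlloyd"
  shows "do { u \<leftarrow> uniform_bits (consumed_bits prot TYPE('w::len) (Suc t));
      map_pmf (server_messages \<circ> snd) (run prot \<sigma> ((!) u) D (Suc t)) }
    = do { u \<leftarrow> uniform_bits (consumed_bits prot TYPE('w) t);
        ms \<leftarrow> map_pmf (server_messages \<circ> snd) (run prot \<sigma> ((!) u) D t);
        us \<leftarrow> pmf_of_set (upload_space prot :: ('w word list list \<times> 'w word list list) set);
        map_pmf (\<lambda>(mR, mC). ms @ server_messages [mR, mC]) (respond_both prot \<sigma> us) }"
proof -
  let ?n = "consumed_bits prot TYPE('w) t" and ?m = "block_bits prot TYPE('w)"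
  let ?S = "upload_space prot :: ('w word list list \<times> 'w word list list) set"
  have append: "server_messages (tr @ tr') = server_messages tr @ server_messages tr'"
    for tr tr' :: "('w word list list \<times> 'w word list) list"
    by (simp add: server_messages_def)
  have "do { u \<leftarrow> uniform_bits (consumed_bits prot TYPE('w) (Suc t));
      map_pmf (server_messages \<circ> snd) (run prot \<sigma> ((!) u) D (Suc t)) }
    = do { u \<leftarrow> uniform_bits ?n; v \<leftarrow> uniform_bits ?m;
        map_pmf (server_messages \<circ> snd) (run prot \<sigma> ((!) (u @ v)) D (Suc t)) }"
    by (simp add: consumed_bits_Suc uniform_bits_add bind_assoc_pmf bind_return_pmf)
  also have "\<dots> = do { u \<leftarrow> uniform_bits ?n; v \<leftarrow> uniform_bits ?m; (\<mu>, tr) \<leftarrow> run prot \<sigma> ((!) u) D t;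
        map_pmf (\<lambda>(mR, mC). server_messages tr @ server_messages [mR, mC])
          (respond_both prot \<sigma> (uploads prot ((!) (u @ v)) D t \<mu> :: 'w word list list \<times> 'w word list list)) }"
  proof (intro bind_pmf_cong refl)
    fix u v assume "u \<in> set_pmf (uniform_bits ?n)"
    then have "run prot \<sigma> ((!) (u @ v)) D t = (run prot \<sigma> ((!) u) D t :: (_ \<times> ('w word list list \<times> _) list) pmf)"
      by (intro run_cong) (simp add: nth_append)
    then show "map_pmf (server_messages \<circ> snd) (run prot \<sigma> ((!) (u @ v)) D (Suc t))
      = do { (\<mu>, tr) \<leftarrow> run prot \<sigma> ((!) u) D t;
        map_pmf (\<lambda>(mR, mC). server_messages tr @ server_messages [mR, mC])
          (respond_both prot \<sigma> (uploads prot ((!) (u @ v)) D t \<mu> :: 'w word list list \<times> 'w word list list)) }"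
      by (simp add: run_Suc map_bind_pmf case_prod_unfold pmf.map_comp comp_def append)
  qed
  \<comment> \<open>The fresh bits \<open>v\<close> are moved behind the first \<open>t\<close>
    iterations, which read only \<open>u\<close>. Once \<open>\<mu>\<close> is fixed,
    \<open>uploads_uniform\<close> applies for each of its values.\<close>
  also have "\<dots> = do { u \<leftarrow> uniform_bits ?n; (\<mu>, tr) \<leftarrow> run prot \<sigma> ((!) u) D t;
        us \<leftarrow> map_pmf (\<lambda>v. uploads prot ((!) (u @ v)) D t \<mu>) (uniform_bits ?m);
        map_pmf (\<lambda>(mR, mC). server_messages tr @ server_messages [mR, mC])
          (respond_both prot \<sigma> (us :: 'w word list list \<times> 'w word list list)) }"
    by (subst bind_commute_pmf) (simp add: bind_map_pmf case_prod_unfold)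
  also have "\<dots> = do { u \<leftarrow> uniform_bits ?n; (\<mu>, tr) \<leftarrow> run prot \<sigma> ((!) u) D t;
        us \<leftarrow> pmf_of_set ?S;
        map_pmf (\<lambda>(mR, mC). server_messages tr @ server_messages [mR, mC]) (respond_both prot \<sigma> us) }"
    by (intro bind_pmf_cong refl) (simp add: uploads_uniform)
  finally show ?thesis
    by (simp add: bind_map_pmf comp_def case_prod_unfold)
qed

lemma server_messages_independent:
  fixes prot :: "'d::finite fastlloyd"
  shows "do { u \<leftarrow> uniform_bits (consumed_bits prot TYPE('w::len) t);
      map_pmf (server_messages \<circ> snd) (run prot \<sigma> ((!) u) D t) }
    = do { u \<leftarrow> uniform_bits (consumed_bits prot TYPE('w) t);
      map_pmf (server_messages \<circ> snd) (run prot \<sigma> ((!) u) D' t :: (_ \<times> ('w word list list \<times> _) list) pmf) }"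
proof (induction t)
  case 0
  show ?case by simp
next
  case (Suc t)
  show ?case
    unfolding server_messages_run_Suc bind_assoc_pmf [symmetric] Suc.IH ..
qed

text \<open>Two replacements of the generator by uniform bits, one for each dataset, give the factor
  2; between them the distributions are equal. The continuation \<open>h\<close> consists of the run
  followed by the adversary.\<close>

lemma server_view_close:
  fixes prot :: "'d::finite fastlloyd"
  defines "l \<equiv> consumed_bits prot TYPE('w::len) (iterations prot)"
  shows "\<bar>pmf (do { v \<leftarrow> fastlloyd_view prot \<sigma> Server n D; f (v :: 'w view) }) y
      - pmf (do { v \<leftarrow> fastlloyd_view prot \<sigma> Server n D'; f v }) y\<bar> \<le> 2 * prefix_distance (prng prot) l n"
proof -
  let ?T = "iterations prot"
  define h where "h D u = do {
      ms \<leftarrow> map_pmf (server_messages \<circ> snd) (run prot (\<sigma> n) ((!) u) D ?T :: (_ \<times> ('w word list list \<times> _) list) pmf);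
      f ([], ms) }" for D u
  have view: "do { v \<leftarrow> fastlloyd_view prot \<sigma> Server n D; f v }
      = do { s \<leftarrow> uniform_bits n; h D (map (prng prot s) [0..<l]) }" for D
  proof -
    have "run prot (\<sigma> n) (prng prot s) D ?T
        = (run prot (\<sigma> n) ((!) (map (prng prot s) [0..<l])) D ?T :: (_ \<times> ('w word list list \<times> _) list) pmf)" for s
      by (rule run_cong) (simp add: l_def)
    then show ?thesis
      by (simp add: fastlloyd_view_def h_def bind_assoc_pmf bind_return_pmf bind_map_pmf case_prod_unfold
          server_messages_def)
  qed
  have "uniform_bits l \<bind> h D = uniform_bits l \<bind> h D'"
    unfolding h_def bind_assoc_pmf [symmetric] l_def by (subst server_messages_independent) (rule refl)
  then have "pmf (uniform_bits l \<bind> h D) y = pmf (uniform_bits l \<bind> h D') y" by simp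
  then show ?thesis
    using pmf_bind_prefix_distance [of n "h D" "prng prot" l y] pmf_bind_prefix_distance [of n "h D'" "prng prot" l y]
    unfolding view by linarith
qed

section \<open>The view of a client\<close>

lemma gauss_dominated_pair:
  assumes "gauss_dominated v P P'" "gauss_dominated w Q Q'" "0 \<le> v" "0 \<le> w"
  shows "gauss_dominated (v + w) (pair_pmf P Q) (pair_pmf P' Q')"
  unfolding pair_pmf_def using assms
  by (intro gauss_dominated_bind gauss_dominated_bind_same)

text \<open>Integer sums before any reduction modulo 2^w. Divergences are compared here, and
  wrap-around is a map applied later.\<close>

definition totals :: "nat \<Rightarrow> nat \<Rightarrow> real list list \<Rightarrow> int list" where
  "totals q l vs = map (\<lambda>e. \<Sum>v\<leftarrow>vs. round (v ! e * 2 ^ q)) [0..<l]"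

lemma length_totals [simp]: "length (totals q l vs) = l"
  by (simp add: totals_def)

definition client_message :: "nat \<Rightarrow> 'w word list list \<times> 'w word list \<Rightarrow> 'w::len word list \<times> 'w word list" where
  "client_message a = (\<lambda>(u, b). (u ! a, b))"

lemma sum_list_masked:
  assumes "length vs = length rs" "\<And>v. v \<in> set vs \<Longrightarrow> length v = l" "\<And>r. r \<in> set rs \<Longrightarrow> length r = l" "e < l"
  shows "(\<Sum>u\<leftarrow>masked q vs rs. u ! e) = (\<Sum>r\<leftarrow>rs. r ! e) + word_of_int (\<Sum>v\<leftarrow>vs. round (v ! e * 2 ^ q))"
  using assms
proof (induction vs rs rule: list_induct2)
  case Nil
  show ?case by (simp add: masked_def)
next
  case (Cons v vs r rs)
  then have "(\<Sum>u\<leftarrow>masked q vs rs. u ! e) = (\<Sum>r\<leftarrow>rs. r ! e) + word_of_int (\<Sum>v\<leftarrow>vs. round (v ! e * 2 ^ q))"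
    by simp
  with Cons.prems show ?case
    by (simp add: masked_def encode_fixed_def algebra_simps)
qed

text \<open>The masks add up separately, so the broadcast is a function of the noisy integer totals
  and the mask sum. The client's own upload is determined by its own row and mask.\<close>

lemma map_client_message_respond:
  assumes vs: "vs \<in> matrices m l" and rs: "rs \<in> matrices m l" and a: "a < m"
  shows "map_pmf (client_message a) (respond q l s (masked q vs rs))
    = map_pmf (\<lambda>z. (map2 (+) (encode_fixed q (vs ! a)) (rs ! a), map2 (\<lambda>r z. r + word_of_int z) (sum_lists l rs) z))
        (map_pmf (map2 (+) (totals q l vs)) (replicate_pmf l (rounded_normal s q)))"
  unfolding respond_def pmf.map_comp
proof (intro map_pmf_cong refl)
  fix noise assume "noise \<in> set_pmf (replicate_pmf l (rounded_normal s q))"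
  then have len: "length noise = l" by (simp add: set_replicate_pmf)
  have rows: "length vs = m" "\<And>v. v \<in> set vs \<Longrightarrow> length v = l"
    "length rs = m" "\<And>r. r \<in> set rs \<Longrightarrow> length r = l"
    using vs rs by (auto simp: matrices_def)
  have "masked q vs rs ! a = map2 (+) (encode_fixed q (vs ! a)) (rs ! a)"
    using rows a by (simp add: masked_def)
  moreover have "map2 (+) (sum_lists l (masked q vs rs)) (map word_of_int noise)
      = map2 (\<lambda>r z. r + word_of_int z) (sum_lists l rs) (map2 (+) (totals q l vs) noise)"
    using rows len
    by (intro nth_equalityI) (simp_all add: sum_lists_def totals_def sum_list_masked [where l = l])
  ultimately show "(client_message a \<circ> (\<lambda>noise. (masked q vs rs,
        map2 (+) (sum_lists l (masked q vs rs)) (map word_of_int noise)))) noise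
      = ((\<lambda>z. (map2 (+) (encode_fixed q (vs ! a)) (rs ! a), map2 (\<lambda>r z. r + word_of_int z) (sum_lists l rs) z))
        \<circ> map2 (+) (totals q l vs)) noise"
    by (simp add: client_message_def)
qed

text \<open>Equal masks and an equal row \<open>a\<close> make the map from noisy totals to messages
  the same on both sides, so it is post-processing of independent rounded Gaussians.\<close>

lemma gauss_dominated_respond:
  assumes "0 < s"
    and vs: "vs \<in> matrices m l" and vs': "vs' \<in> matrices m l"
    and rs: "rs \<in> matrices m l" and a: "a < m" "vs ! a = vs' ! a"
    and bound: "(\<Sum>e<l. (real_of_int (totals q l vs ! e - totals q l vs' ! e) / (2 ^ q * s))\<^sup>2) \<le> v"
  shows "gauss_dominated v (map_pmf (client_message a) (respond q l s (masked q vs rs)))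
    (map_pmf (client_message a) (respond q l s (masked q vs' rs)))"
proof -
  let ?sum = "\<Sum>(x, y)\<leftarrow>zip (totals q l vs) (totals q l vs'). (real_of_int (x - y) / (2 ^ q * s))\<^sup>2"
  have "?sum = (\<Sum>e<l. (real_of_int (totals q l vs ! e - totals q l vs' ! e) / (2 ^ q * s))\<^sup>2)"
    by (simp add: sum_list_sum_nth atLeast0LessThan)
  then have "0 \<le> ?sum" "?sum \<le> v"
    using bound by (auto intro: sum_nonneg)
  then have "gauss_dominated v
      (map_pmf (map2 (+) (totals q l vs)) (replicate_pmf l (rounded_normal s q)))
      (map_pmf (map2 (+) (totals q l vs')) (replicate_pmf l (rounded_normal s q)))" and "0 \<le> v"
    using gauss_dominated_replicate_rounded_normal [OF \<open>0 < s\<close>, of "totals q l vs" "totals q l vs'" q]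
    by (auto intro: gauss_dominated_mono)
  from gauss_dominated_map [OF this] show ?thesis
    unfolding map_client_message_respond [OF vs rs a(1)] map_client_message_respond [OF vs' rs a(1)] a(2) .
qed

section \<open>Sensitivity to one data point and the noise budget\<close>

definition fixed_int :: "nat \<Rightarrow> real \<Rightarrow> int" where
  "fixed_int q y = (if y < 0 then - \<lfloor>\<bar>y\<bar> * 2 ^ q\<rfloor> else \<lfloor>\<bar>y\<bar> * 2 ^ q\<rfloor>)"

lemma fixed_point_nth: "fixed_point q x $ c = real_of_int (fixed_int q (x $ c)) / 2 ^ q"
  by (simp add: fixed_point_def fixed_int_def sgn_if)

lemma norm_fixed_point_le: "norm (fixed_point q x) \<le> norm x"
proof (rule norm_le_componentwise_cart)
  fix c
  define z where "z = \<bar>x $ c\<bar> * 2 ^ q"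
  have "0 \<le> z" by (simp add: z_def)
  then have "\<bar>real_of_int (fixed_int q (x $ c))\<bar> \<le> z"
    unfolding fixed_int_def z_def [symmetric] by simp
  then show "norm (fixed_point q x $ c) \<le> norm (x $ c)"
    by (simp add: fixed_point_nth z_def field_simps)
qed

text \<open>An integer, in units of 2^-q, and additive in the multiset. So rounding a client's entry
  is exact (\<open>round_local_sum\<close>), and sums over clients depend only on the pooled
  data.\<close>

definition cell_sum ::
  "'d::finite fastlloyd \<Rightarrow> (nat \<Rightarrow> real ^ 'd) \<Rightarrow> nat \<Rightarrow> 'd \<Rightarrow> (real ^ 'd) multiset \<Rightarrow> int" where
  "cell_sum prot \<mu> j c U = (\<Sum>x\<in>#assigned prot \<mu> U j. fixed_int (precision prot) ((x - \<mu> j) $ c))"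

definition cell_count :: "'d::finite fastlloyd \<Rightarrow> (nat \<Rightarrow> real ^ 'd) \<Rightarrow> nat \<Rightarrow> (real ^ 'd) multiset \<Rightarrow> int" where
  "cell_count prot \<mu> j U = 2 ^ precision prot * int (size (assigned prot \<mu> U j))"

lemma cell_sum_union: "cell_sum prot \<mu> j c (U + V) = cell_sum prot \<mu> j c U + cell_sum prot \<mu> j c V"
  and cell_count_union: "cell_count prot \<mu> j (U + V) = cell_count prot \<mu> j U + cell_count prot \<mu> j V"
  by (simp_all add: cell_sum_def cell_count_def assigned_def distrib_left)

lemma cell_empty: "cell_sum prot \<mu> j c {#} = 0" "cell_count prot \<mu> j {#} = 0"
  by (simp_all add: cell_sum_def cell_count_def assigned_def)

lemma sum_cell_sum: "(\<Sum>i\<in>A. cell_sum prot \<mu> j c (D i)) = cell_sum prot \<mu> j c (sum D A)"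
  and sum_cell_count: "(\<Sum>i\<in>A. cell_count prot \<mu> j (D i)) = cell_count prot \<mu> j (sum D A)"
  using sum_comp_morphism [of "cell_sum prot \<mu> j c" D A, OF cell_empty(1) cell_sum_union]
    sum_comp_morphism [of "cell_count prot \<mu> j" D A, OF cell_empty(2) cell_count_union]
  by (simp_all add: comp_def)

lemma round_local_sum:
  "round (local_sum prot \<mu> U j $ c * 2 ^ precision prot) = cell_sum prot \<mu> j c U"
proof -
  have "(\<Sum>x\<in>#A. fixed_point q (x - \<mu> j)) $ c = real_of_int (\<Sum>x\<in>#A. fixed_int q ((x - \<mu> j) $ c)) / 2 ^ q" for A q
    by (induction A) (simp_all add: fixed_point_nth add_divide_distrib)
  then show ?thesis by (simp add: local_sum_def cell_sum_def)
qed

lemma round_local_count: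
  "round (local_count prot \<mu> U j * 2 ^ precision prot) = cell_count prot \<mu> j U"
proof -
  have "local_count prot \<mu> U j * 2 ^ precision prot = real_of_int (cell_count prot \<mu> j U)"
    by (simp add: local_count_def cell_count_def)
  then show ?thesis by (simp only: round_of_int)
qed

lemma nth_flatten:
  fixes R :: "nat \<Rightarrow> real ^ 'd::finite"
  assumes "e < k * CARD('d)"
  shows "flatten k R ! e = R (e div CARD('d)) $ from_nat_into UNIV (e mod CARD('d))"
  using assms
proof (induction k)
  case (Suc k)
  have split: "flatten (Suc k) R = flatten k R @ map (\<lambda>c. R k $ from_nat_into UNIV c) [0..<CARD('d)]"
    by (simp add: flatten_def)
  show ?case
  proof (cases "e < k * CARD('d)")
    case True
    then show ?thesis using Suc.IH by (simp add: split nth_append)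
  next
    case False
    define c where "c = e - k * CARD('d)"
    have c: "e = k * CARD('d) + c" "c < CARD('d)"
      using False Suc.prems by (auto simp: c_def)
    then show ?thesis by (simp add: split nth_append)
  qed
qed simp

lemma sum_flat_index:
  fixes f :: "nat \<Rightarrow> 'd::finite \<Rightarrow> real"
  shows "(\<Sum>e<k * CARD('d). f (e div CARD('d)) (from_nat_into UNIV (e mod CARD('d)))) = (\<Sum>j<k. \<Sum>c\<in>UNIV. f j c)"
proof -
  let ?g = "\<lambda>e. f (e div CARD('d)) (from_nat_into UNIV (e mod CARD('d)))"
  have "sum ?g {j * CARD('d)..<j * CARD('d) + CARD('d)} = (\<Sum>c\<in>UNIV. f j c)" for j
  proof -
    have "sum ?g {j * CARD('d)..<j * CARD('d) + CARD('d)} = (\<Sum>i<CARD('d). ?g (j * CARD('d) + i))"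
      using sum.shift_bounds_nat_ivl [of ?g 0 "j * CARD('d)" "CARD('d)"]
      by (simp add: atLeast0LessThan add.commute)
    also have "\<dots> = (\<Sum>i<CARD('d). f j (from_nat_into UNIV i))"
      by (intro sum.cong) auto
    also have "\<dots> = (\<Sum>c\<in>UNIV. f j c)"
      by (rule sum.reindex_bij_betw) (rule bij_betw_from_nat_into_finite, simp)
    finally show ?thesis .
  qed
  then show ?thesis
    by (subst sum.nat_group [symmetric]) simp
qed

text \<open>By additivity the distribution of the points among the clients disappears, which is why
  neighbouring unions suffice.\<close>

lemma totals_offsets:
  fixes prot :: "'d::finite fastlloyd"
  assumes "e < clusters prot * CARD('d)"
  shows "totals (precision prot) (clusters prot * CARD('d)) (offsets prot \<mu> D) ! e
    = cell_sum prot \<mu> (e div CARD('d)) (from_nat_into UNIV (e mod CARD('d))) (\<Sum>i<clients prot. D i)"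
  using assms
  by (simp add: totals_def offsets_def comp_def nth_flatten round_local_sum interv_sum_list_conv_sum_set_nat
      sum_cell_sum atLeast0LessThan)

lemma totals_counts:
  assumes "j < clusters prot"
  shows "totals (precision prot) (clusters prot) (counts prot \<mu> D) ! j
    = cell_count prot \<mu> j (\<Sum>i<clients prot. D i)"
  using assms
  by (simp add: totals_def counts_def comp_def round_local_count interv_sum_list_conv_sum_set_nat
      sum_cell_count atLeast0LessThan)

text \<open>Truncation towards 0 shrinks every coordinate, so the radius bounds the truncated offset
  as well, without a surcharge for rounding.\<close>

lemma cell_sum_sensitivity:
  fixes prot :: "'d::finite fastlloyd"
  shows "(\<Sum>j<clusters prot. \<Sum>c\<in>UNIV. (real_of_int (cell_sum prot \<mu> j c {#x#}) / 2 ^ precision prot)\<^sup>2) \<le> (radius prot)\<^sup>2"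
proof -
  let ?j = "nearest (clusters prot) \<mu> x"
  have "(\<Sum>c\<in>UNIV. (real_of_int (cell_sum prot \<mu> j c {#x#}) / 2 ^ precision prot)\<^sup>2)
      \<le> (if j = ?j then (radius prot)\<^sup>2 else 0)" for j
  proof (cases "j = ?j \<and> dist x (\<mu> j) < radius prot")
    case True
    have "?j = j" using True by (rule conjunct1 [THEN sym])
    moreover have "dist x (\<mu> j) < radius prot" using True by (rule conjunct2)
    ultimately have "(\<Sum>c\<in>UNIV. (real_of_int (cell_sum prot \<mu> j c {#x#}) / 2 ^ precision prot)\<^sup>2)
        = (norm (fixed_point (precision prot) (x - \<mu> j)))\<^sup>2"
      by (simp add: power_divide cell_sum_def assigned_def fixed_point_nth norm_vec_def L2_set_def sum_nonneg)
    also have "\<dots> \<le> (radius prot)\<^sup>2"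
      using \<open>dist x (\<mu> j) < radius prot\<close> norm_fixed_point_le [of "precision prot" "x - \<mu> j"]
      by (intro power_mono) (auto simp: dist_norm)
    finally show ?thesis using True by simp
  next
    case False
    then show ?thesis by (auto simp: cell_sum_def assigned_def)
  qed
  then have "(\<Sum>j<clusters prot. \<Sum>c\<in>UNIV. (real_of_int (cell_sum prot \<mu> j c {#x#}) / 2 ^ precision prot)\<^sup>2)
      \<le> (\<Sum>j<clusters prot. if j = ?j then (radius prot)\<^sup>2 else 0)"
    by (intro sum_mono)
  also have "\<dots> \<le> (radius prot)\<^sup>2"
    by simp
  finally show ?thesis .
qed

lemma cell_count_sensitivity:
  "(\<Sum>j<clusters prot. (real_of_int (cell_count prot \<mu> j {#x#}) / 2 ^ precision prot)\<^sup>2) \<le> 1"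
proof -
  have "(\<Sum>j<clusters prot. (real_of_int (cell_count prot \<mu> j {#x#}) / 2 ^ precision prot)\<^sup>2)
      \<le> (\<Sum>j<clusters prot. if j = nearest (clusters prot) \<mu> x then 1 else 0)"
    by (intro sum_mono) (auto simp: cell_count_def assigned_def)
  also have "\<dots> \<le> 1"
    by simp
  finally show ?thesis .
qed

text \<open>With a = sqrt(4d), the offsets take the share a / (1 + a) of the round's budget and the
  counts take 1 / (1 + a). The fourth root in \<open>sigma_R\<close> is the square root of
  a.\<close>

lemma noise_budget:
  fixes prot :: "'d::finite fastlloyd"
  assumes "0 < \<sigma>" "0 < radius prot" "1 \<le> iterations prot"
  shows "(radius prot / noise_R prot \<sigma>)\<^sup>2 + (1 / noise_C prot \<sigma>)\<^sup>2 = 1 / (real (iterations prot) * \<sigma>\<^sup>2)"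
    and "0 < noise_R prot \<sigma>" and "0 < noise_C prot \<sigma>"
proof -
  define a where "a = sqrt (4 * real CARD('d))"
  have a: "0 < a" by (simp add: a_def)
  define b where "b = root 4 (4 * real CARD('d))"
  have "b = sqrt a"
    using real_root_mult_exp [of 2 2 "4 * real CARD('d)"] by (simp add: sqrt_def a_def b_def)
  then have b: "0 < b" "b\<^sup>2 = a" using a by simp_all
  have noise: "noise_R prot \<sigma> = \<sigma> * sqrt (1 + a) / b * radius prot * sqrt (real (iterations prot))"
    "noise_C prot \<sigma> = \<sigma> * sqrt (1 + a) * sqrt (real (iterations prot))"
    by (simp_all only: noise_R_def noise_C_def sigma_R_def sigma_C_def a_def b_def)
  have T: "0 < real (iterations prot)" using assms(3) by simp
  show "0 < noise_R prot \<sigma>" "0 < noise_C prot \<sigma>"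
    using assms a b T by (simp_all add: noise add_pos_pos)
  have "(radius prot / noise_R prot \<sigma>)\<^sup>2 = a / (1 + a) / (real (iterations prot) * \<sigma>\<^sup>2)"
    using assms a b T by (simp add: noise field_simps)
  moreover have "(1 / noise_C prot \<sigma>)\<^sup>2 = 1 / (1 + a) / (real (iterations prot) * \<sigma>\<^sup>2)"
    using assms a T by (simp add: noise power_divide power_mult_distrib)
  ultimately have "(radius prot / noise_R prot \<sigma>)\<^sup>2 + (1 / noise_C prot \<sigma>)\<^sup>2
      = (a / (1 + a) + 1 / (1 + a)) / (real (iterations prot) * \<sigma>\<^sup>2)"
    by (simp only: add_divide_distrib)
  moreover have "a / (1 + a) + 1 / (1 + a) = 1" using a by (simp add: add_divide_distrib [symmetric])
  ultimately show "(radius prot / noise_R prot \<sigma>)\<^sup>2 + (1 / noise_C prot \<sigma>)\<^sup>2 = 1 / (real (iterations prot) * \<sigma>\<^sup>2)"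
    by simp
qed

text \<open>Absolute values treat addition and removal alike. The point x is chosen before the
  centroids, so one witness serves all cells.\<close>

lemma neighbouring_cell:
  assumes "neighbouring X U U'"
  obtains x where
    "\<And>prot \<mu> j c. \<bar>cell_sum prot \<mu> j c U - cell_sum prot \<mu> j c U'\<bar> = \<bar>cell_sum prot \<mu> j c {#x#}\<bar>"
    "\<And>prot \<mu> j. \<bar>cell_count prot \<mu> j U - cell_count prot \<mu> j U'\<bar> = \<bar>cell_count prot \<mu> j {#x#}\<bar>"
proof -
  obtain x where "U' = U + {#x#} \<or> U = U' + {#x#}"
    using assms by (auto simp: neighbouring_def)
  then show thesis
  proof
    assume "U' = U + {#x#}"
    then show thesis
      by (intro that [of x]) (simp_all only: cell_sum_union cell_count_union)
  next
    assume "U = U' + {#x#}"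
    then show thesis
      by (intro that [of x]) (simp_all only: cell_sum_union cell_count_union)
  qed
qed

section \<open>Composition over the rounds and the final bound\<close>

definition client_round ::
  "'d::finite fastlloyd \<Rightarrow> real \<Rightarrow> nat \<Rightarrow> (nat \<Rightarrow> bool) \<Rightarrow> (nat \<Rightarrow> (real ^ 'd) multiset) \<Rightarrow> nat \<Rightarrow>
    (nat \<Rightarrow> real ^ 'd) \<Rightarrow> (('w::len word list \<times> 'w word list) \<times> ('w word list \<times> 'w word list)) pmf" where
  "client_round prot \<sigma> a g D t \<mu> =
     map_pmf (\<lambda>(mR, mC). (client_message a mR, client_message a mC)) (respond_both prot \<sigma> (uploads prot g D t \<mu>))"

text \<open>Both sides share \<open>\<mu>\<close>: adaptive composition compares the rounds for one
  and the same history.\<close>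

lemma gauss_dominated_client_round:
  fixes prot :: "'d::finite fastlloyd"
  assumes "0 < \<sigma>" "0 < radius prot" "1 \<le> iterations prot" "a < clients prot" "D a = D' a"
    and "neighbouring X (\<Sum>i<clients prot. D i) (\<Sum>i<clients prot. D' i)"
  shows "gauss_dominated (1 / (real (iterations prot) * \<sigma>\<^sup>2))
    (client_round prot \<sigma> a g D t \<mu> :: (('w::len word list \<times> _) \<times> _) pmf) (client_round prot \<sigma> a g D' t \<mu>)"
proof -
  let ?U = "\<Sum>i<clients prot. D i" and ?U' = "\<Sum>i<clients prot. D' i"
  let ?q = "precision prot" and ?k = "clusters prot"
  note pos = noise_budget(2,3) [OF assms(1-3)]
  obtain x where x:
    "\<And>j c. \<bar>cell_sum prot \<mu> j c ?U - cell_sum prot \<mu> j c ?U'\<bar> = \<bar>cell_sum prot \<mu> j c {#x#}\<bar>"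
    "\<And>j. \<bar>cell_count prot \<mu> j ?U - cell_count prot \<mu> j ?U'\<bar> = \<bar>cell_count prot \<mu> j {#x#}\<bar>"
    using neighbouring_cell [OF assms(6)] by metis
  have square: "(real_of_int (m - n) / (2 ^ ?q * s))\<^sup>2 = (real_of_int z / 2 ^ ?q)\<^sup>2 / s\<^sup>2"
    if "\<bar>m - n\<bar> = \<bar>z\<bar>" for m n z :: int and s :: real
  proof -
    have "(real_of_int (m - n))\<^sup>2 = (real_of_int z)\<^sup>2"
      using that by (metis of_int_abs power2_abs)
    then show ?thesis by (simp add: power_divide power_mult_distrib)
  qed
  have "(\<Sum>e<?k * CARD('d). (real_of_int (totals ?q (?k * CARD('d)) (offsets prot \<mu> D) ! e
      - totals ?q (?k * CARD('d)) (offsets prot \<mu> D') ! e) / (2 ^ ?q * noise_R prot \<sigma>))\<^sup>2)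
    = (\<Sum>e<?k * CARD('d). (real_of_int (cell_sum prot \<mu> (e div CARD('d)) (from_nat_into UNIV (e mod CARD('d))) {#x#}) / 2 ^ ?q)\<^sup>2
        / (noise_R prot \<sigma>)\<^sup>2)"
    by (intro sum.cong refl square) (simp add: totals_offsets x)
  also have "\<dots> = (\<Sum>j<?k. \<Sum>c\<in>UNIV. (real_of_int (cell_sum prot \<mu> j c {#x#}) / 2 ^ ?q)\<^sup>2) / (noise_R prot \<sigma>)\<^sup>2"
    by (subst sum_flat_index [of "\<lambda>j c. (real_of_int (cell_sum prot \<mu> j c {#x#}) / 2 ^ ?q)\<^sup>2 / (noise_R prot \<sigma>)\<^sup>2"])
      (simp add: sum_divide_distrib)
  also have "\<dots> \<le> (radius prot / noise_R prot \<sigma>)\<^sup>2"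
    unfolding power_divide [of "radius prot"] by (intro divide_right_mono cell_sum_sensitivity) simp
  finally have R: "gauss_dominated ((radius prot / noise_R prot \<sigma>)\<^sup>2)
      (map_pmf (client_message a) (respond ?q (?k * CARD('d)) (noise_R prot \<sigma>)
        (masked ?q (offsets prot \<mu> D) (masks_R prot g t :: 'w word list list))))
      (map_pmf (client_message a) (respond ?q (?k * CARD('d)) (noise_R prot \<sigma>)
        (masked ?q (offsets prot \<mu> D') (masks_R prot g t))))"
    using pos assms(4,5)
    by (intro gauss_dominated_respond [OF _ data_in_matrices(1) data_in_matrices(1) masks_in_matrices(1)]) (auto simp: offsets_def)
  have "(\<Sum>j<?k. (real_of_int (totals ?q ?k (counts prot \<mu> D) ! j
      - totals ?q ?k (counts prot \<mu> D') ! j) / (2 ^ ?q * noise_C prot \<sigma>))\<^sup>2)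
    = (\<Sum>j<?k. (real_of_int (cell_count prot \<mu> j {#x#}) / 2 ^ ?q)\<^sup>2 / (noise_C prot \<sigma>)\<^sup>2)"
    by (intro sum.cong refl square) (simp add: totals_counts x)
  also have "\<dots> \<le> (1 / noise_C prot \<sigma>)\<^sup>2"
    unfolding power_divide [of 1] sum_divide_distrib [symmetric] power_one
    by (intro divide_right_mono cell_count_sensitivity) simp
  finally have C: "gauss_dominated ((1 / noise_C prot \<sigma>)\<^sup>2)
      (map_pmf (client_message a) (respond ?q ?k (noise_C prot \<sigma>)
        (masked ?q (counts prot \<mu> D) (masks_C prot g t :: 'w word list list))))
      (map_pmf (client_message a) (respond ?q ?k (noise_C prot \<sigma>)
        (masked ?q (counts prot \<mu> D') (masks_C prot g t))))"
    using pos assms(4,5)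
    by (intro gauss_dominated_respond [OF _ data_in_matrices(2) data_in_matrices(2) masks_in_matrices(2)]) (auto simp: counts_def)
  show ?thesis
    unfolding client_round_def respond_both_def uploads_def prod.case map_pair
      noise_budget(1) [OF assms(1-3), symmetric]
    by (rule gauss_dominated_pair [OF R C]) simp_all
qed

definition client_messages :: "nat \<Rightarrow> ('w word list list \<times> 'w word list) list \<Rightarrow> 'w::len word list list" where
  "client_messages a tr = concat (map (\<lambda>(u, b). [u ! a, b]) tr)"

text \<open>The centroids are kept next to the messages, since the next round is a kernel in them.
  They may be exposed because, for a fixed stream \<open>g\<close>, they are computed from the
  broadcasts.\<close>

lemma gauss_dominated_client:
  fixes prot :: "'d::finite fastlloyd"
  assumes "0 < \<sigma>" "0 < radius prot" "1 \<le> iterations prot" "a < clients prot" "D a = D' a"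
    and "neighbouring X (\<Sum>i<clients prot. D i) (\<Sum>i<clients prot. D' i)"
  shows "gauss_dominated (real t / (real (iterations prot) * \<sigma>\<^sup>2))
    (map_pmf (map_prod id (client_messages a)) (run prot \<sigma> g D t :: (_ \<times> ('w::len word list list \<times> _) list) pmf))
    (map_pmf (map_prod id (client_messages a)) (run prot \<sigma> g D' t))"
proof (induction t)
  case 0
  show ?case by (simp add: gauss_dominated_refl)
next
  case (Suc t)
  let ?view = "\<lambda>D t. map_pmf (map_prod id (client_messages a))
    (run prot \<sigma> g D t :: (_ \<times> ('w::len word list list \<times> _) list) pmf)"
  have step: "?view D (Suc t) = ?view D t \<bind> (\<lambda>(\<mu>, ms). map_pmf (\<lambda>(mR, mC).
      (next_centroids prot g t (snd mR) (snd mC) \<mu>, ms @ [fst mR, snd mR, fst mC, snd mC]))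
      (client_round prot \<sigma> a g D t \<mu>))" for D
    by (simp add: run_Suc client_round_def map_bind_pmf bind_map_pmf pmf.map_comp comp_def case_prod_unfold
        client_messages_def client_message_def)
  have "gauss_dominated (real t / (real (iterations prot) * \<sigma>\<^sup>2) + 1 / (real (iterations prot) * \<sigma>\<^sup>2))
      (?view D (Suc t)) (?view D' (Suc t))"
    unfolding step case_prod_unfold
    by (intro gauss_dominated_bind [OF Suc.IH] gauss_dominated_map [OF gauss_dominated_client_round [OF assms]]) simp_all
  moreover have "real (Suc t) / (real (iterations prot) * \<sigma>\<^sup>2)
      = real t / (real (iterations prot) * \<sigma>\<^sup>2) + 1 / (real (iterations prot) * \<sigma>\<^sup>2)"
    by (simp add: add_divide_distrib)
  ultimately show ?case by (simp only:)
qed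

text \<open>The seed has the same distribution for both datasets and contributes parameter 0; for
  each seed, the T rounds add up to the square of 1 / \<open>\<sigma> n\<close>.\<close>

lemma gauss_dominated_client_view:
  fixes prot :: "'d::finite fastlloyd"
  assumes "0 < \<sigma> n" "0 < radius prot" "1 \<le> iterations prot" "a < clients prot" "D a = D' a"
    and "neighbouring X (\<Sum>i<clients prot. D i) (\<Sum>i<clients prot. D' i)"
  shows "gauss_dominated ((1 / \<sigma> n)\<^sup>2) (fastlloyd_view prot \<sigma> (Client a) n D :: 'w::len view pmf)
    (fastlloyd_view prot \<sigma> (Client a) n D')"
proof -
  let ?T = "iterations prot"
  have view: "(fastlloyd_view prot \<sigma> (Client a) n D :: 'w view pmf) = do {
      s \<leftarrow> uniform_bits n;
      map_pmf (\<lambda>(\<mu>, ms). (s, ms)) (map_pmf (map_prod id (client_messages a)) (run prot (\<sigma> n) (prng prot s) D ?T)) }" for D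
    by (simp add: fastlloyd_view_def map_pmf_def bind_assoc_pmf bind_return_pmf case_prod_unfold client_messages_def)
  have "real ?T / (real ?T * (\<sigma> n)\<^sup>2) = (1 / \<sigma> n)\<^sup>2"
    using assms(3) by (simp add: power_divide)
  then have run: "gauss_dominated ((1 / \<sigma> n)\<^sup>2)
      (map_pmf (map_prod id (client_messages a)) (run prot (\<sigma> n) g D ?T :: (_ \<times> ('w word list list \<times> _) list) pmf))
      (map_pmf (map_prod id (client_messages a)) (run prot (\<sigma> n) g D' ?T))" for g
    using gauss_dominated_client [OF assms, of ?T] by (simp only:)
  show ?thesis
    unfolding view
    using gauss_dominated_bind [OF gauss_dominated_refl [of 0] gauss_dominated_map [OF run]] by simp
qed

lemma neighbouring_pool:
  assumes "a < M" "D a = D' a" "neighbouring X (honest_data M (Client a) D) (honest_data M (Client a) D')"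
  shows "neighbouring X (\<Sum>i<M. D i) (\<Sum>i<M. D' i)"
proof -
  have "{i. i < M \<and> Client i \<noteq> Client a} = {..<M} - {a}" by auto
  then have "(\<Sum>i<M. D i) = D a + honest_data M (Client a) D" for D :: "nat \<Rightarrow> 'a multiset"
    using \<open>a < M\<close> by (simp add: honest_data_def sum.remove [of "{..<M}" a D])
  then show ?thesis
    using assms(2,3) by (auto simp: neighbouring_def)
qed

theorem theorem5p2:
  fixes prot :: "'d::finite fastlloyd"
    and \<epsilon> \<sigma> :: "nat \<Rightarrow> real"
    and \<delta> :: real
  assumes "1 \<le> clients prot" and "1 \<le> clusters prot" and "1 \<le> iterations prot"
    and "0 < radius prot" and "0 < bound prot"
    and "secure_prng (prng prot)"
    and "\<And>n. 0 < \<epsilon> n" and "0 < \<delta>" and "\<delta> < 1"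
    and "\<And>n. calibrated (\<epsilon> n) \<delta> (\<sigma> n)"
  shows "ind_cdp_mpc (clients prot) (data_box (bound prot)) encode_view
    (fastlloyd_view prot \<sigma> :: party \<Rightarrow> nat \<Rightarrow> (nat \<Rightarrow> (real ^ 'd) multiset) \<Rightarrow> 'w::len view pmf) \<epsilon> \<delta>"
  unfolding ind_cdp_mpc_def
proof (intro ballI allI impI)
  fix P A p and repr :: "nat \<Rightarrow> (real ^ 'd) multiset \<Rightarrow> bool list"
  assume P: "P \<in> parties (clients prot)"
  let ?view = "fastlloyd_view prot \<sigma> :: party \<Rightarrow> nat \<Rightarrow> (nat \<Rightarrow> (real ^ 'd) multiset) \<Rightarrow> 'w view pmf"
  let ?out = "\<lambda>n D. do { v \<leftarrow> ?view P n D; decision A p n (encode_view v @ repr n (own_data P D)) }"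
  show "\<exists>\<nu>. negligible \<nu> \<and> (\<forall>n D D'.
      (\<forall>i<clients prot. set_mset (D i) \<subseteq> data_box (bound prot) \<and> set_mset (D' i) \<subseteq> data_box (bound prot)) \<and>
      own_data P D = own_data P D' \<and>
      neighbouring (data_box (bound prot)) (honest_data (clients prot) P D) (honest_data (clients prot) P D') \<longrightarrow>
      pmf (?out n D) True \<le> exp (\<epsilon> n) * pmf (?out n D') True + \<nu> n + \<delta>)"
  proof (cases P)
    case Server
    \<comment> \<open>Chosen before the datasets: the distance depends only on the generator and the
      number of consumed bits.\<close>
    define \<nu> where "\<nu> n = 2 * prefix_distance (prng prot) (consumed_bits prot TYPE('w) (iterations prot)) n" for n
    have "negligible \<nu>"
      unfolding \<nu>_def by (intro negligible_cmult negligible_prefix_distance assms)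
    moreover have "pmf (?out n D) True \<le> exp (\<epsilon> n) * pmf (?out n D') True + \<nu> n + \<delta>" for n D D'
    proof -
      have "pmf (?out n D) True \<le> 1 * pmf (?out n D') True + \<nu> n"
        using server_view_close [where n = n and D = D and D' = D' and y = True and prot = prot and \<sigma> = \<sigma>
            and f = "\<lambda>v :: 'w view. decision A p n (encode_view v @ repr n {#})"]
        unfolding Server \<nu>_def by simp
      also have "1 * pmf (?out n D') True \<le> exp (\<epsilon> n) * pmf (?out n D') True"
        using assms(7) [of n] by (intro mult_right_mono) auto
      finally show ?thesis using \<open>0 < \<delta>\<close> by simp
    qed
    ultimately show ?thesis by blast
  next
    case (Client a)
    then have a: "a < clients prot" using P by (auto simp: parties_def)
    have "pmf (?out n D) True \<le> exp (\<epsilon> n) * pmf (?out n D') True + \<delta>"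
      if "own_data P D = own_data P D'"
        "neighbouring (data_box (bound prot)) (honest_data (clients prot) P D) (honest_data (clients prot) P D')" for n D D'
    proof -
      have own: "D a = D' a" using that(1) Client by simp
      have \<sigma>: "0 < \<sigma> n" "gauss_delta (\<epsilon> n) (1 / \<sigma> n) \<le> \<delta>"
        using assms(10) [of n] by (simp_all add: calibrated_def Let_def)
      have "gauss_dominated ((1 / \<sigma> n)\<^sup>2) (?out n D) (?out n D')"
        using gauss_dominated_client_view [of \<sigma> n prot a D D', OF \<sigma>(1) assms(4,3) a own
            neighbouring_pool [OF a own that(2) [unfolded Client]], where 'w = 'w]
        unfolding Client by (simp add: own gauss_dominated_bind_same)
      \<comment> \<open>The calibration enters here, with theta = 1 / \<open>\<sigma> n\<close>,
        whose square is the accumulated parameter.\<close>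
      moreover have "gauss_profile ((1 / \<sigma> n)\<^sup>2) (exp (\<epsilon> n)) \<le> ennreal \<delta>"
        using \<sigma> by (simp only: gauss_profile_exp ennreal_leI divide_pos_pos zero_less_one)
      ultimately show ?thesis
        using \<open>0 < \<delta>\<close> by (intro pmf_le_gauss_profile) auto
    qed
    moreover have "negligible (\<lambda>_. 0)" by (simp add: negligible_def)
    ultimately show ?thesis by (intro exI [of _ "\<lambda>_. 0"]) simp
  qed
qed

end
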